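(* Let $\sigma>0$ and let $\omega(z)=P(z)+iQ(z)$, where $P,Q$ are real entire functions of the class $E_\sigma$ and $\omega(x)=o(x)$ as $x\to\pm\infty$ on the real axis. Suppose that for some $\tau\in\mathbb{R}$ $$P(x)\cos(\sigma x+\tau)+Q(x)\sin(\sigma x+\tau)\ge 0,\qquad x\in\mathbb{R}.$$ Let $d(x):=P(x)Q'(x)-P'(x)Q(x)$. Assume that the function $\omega$ is not real up to a constant factor. Then: 1) $\omega\in\overline{HB}$. If $\omega$ has real zeros, then they are simple. 2) For $x_0\in\mathbb{R}$, $d(x_0)=0$ if and only if $\omega(x_0)=0$. If $x_0\in\mathbb{R}$ is a zero of $\omega$, then $x_0$ is a zero of $d$ of multiplicity $2$. 3) For all $n\in\mathbb{N}$, $\omega^{(n)}\in HB$.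
   Context: An entire function $f$ is of exponential type if there are $A>0,B>0$ with $|f(z)|\le Ae^{B|z|}$ for all $z\in\mathbb{C}$; the infimum of such $B$ is the type $\sigma(f)$. $E_\sigma$ is the class of entire functions of exponential type with $\sigma(f)\le\sigma$. A function is called real if it takes real values on the real axis; an entire function is real up to a constant factor if it equals a complex constant times a real entire function. For an entire function $\omega=P+iQ$ with $P,Q$ real entire, $\overline{\omega}(z):=P(z)-iQ(z)=\overline{\omega(\overline z)}$. $HB$ is the class of entire functions $\omega$ that have no zeros in the closed lower half-plane $\operatorname{Im}z\le0$ and satisfy $\bigl|\omega(z)/\overline{\omega}(z)\bigr|<1$ for $\operatorname{Im}z>0$. $\overline{HB}$ is the class of entire functions $\omega$ that have no zeros in the open lower half-plane $\operatorname{Im}z<0$ and satisfy $\bigl|\omega(z)/\overline{\omega}(z)\bigr|\le1$ for $\operatorname{Im}z>0$. *)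

theory Defs
  imports "HOL-Complex_Analysis.Complex_Analysis"
begin

definition entire :: "(complex \<Rightarrow> complex) \<Rightarrow> bool" where
  "entire f \<longleftrightarrow> f holomorphic_on UNIV"

definition exp_bounds :: "(complex \<Rightarrow> complex) \<Rightarrow> real set" where
  "exp_bounds f = {B. B > 0 \<and> (\<exists>A>0. \<forall>z. norm (f z) \<le> A * exp (B * norm z))}"

definition exponential_type :: "(complex \<Rightarrow> complex) \<Rightarrow> bool" where
  "exponential_type f \<longleftrightarrow> exp_bounds f \<noteq> {}"

text \<open>The type is meaningful only under \<^const>\<open>exponential_type\<close>, as the infimum of the
  empty set of reals is unspecified.\<close>

definition exp_type :: "(complex \<Rightarrow> complex) \<Rightarrow> real" where
  "exp_type f = Inf (exp_bounds f)"

definition E_class :: "real \<Rightarrow> (complex \<Rightarrow> complex) set" where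
  "E_class \<sigma> = {f. entire f \<and> exponential_type f \<and> exp_type f \<le> \<sigma>}"

definition real_function :: "(complex \<Rightarrow> complex) \<Rightarrow> bool" where
  "real_function f \<longleftrightarrow> (\<forall>x::real. f (of_real x) \<in> \<real>)"

definition real_up_to_constant :: "(complex \<Rightarrow> complex) \<Rightarrow> bool" where
  "real_up_to_constant f \<longleftrightarrow>
     (\<exists>c g. entire g \<and> real_function g \<and> (\<forall>z. f z = c * g z))"

text \<open>For \<open>\<omega> = P + \<i> Q\<close> with \<open>P\<close>, \<open>Q\<close> real entire this is \<open>P - \<i> Q\<close>.\<close>

definition bar :: "(complex \<Rightarrow> complex) \<Rightarrow> complex \<Rightarrow> complex" where
  "bar \<omega> z = cnj (\<omega> (cnj z))"

text \<open>In both classes the denominator \<open>bar \<omega> z\<close> is nonzero for \<open>Im z > 0\<close>, because \<open>\<omega>\<close> has no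
  zeros in the open lower half-plane.\<close>

definition HB :: "(complex \<Rightarrow> complex) set" where
  "HB = {\<omega>. entire \<omega> \<and> (\<forall>z. Im z \<le> 0 \<longrightarrow> \<omega> z \<noteq> 0) \<and>
             (\<forall>z. Im z > 0 \<longrightarrow> norm (\<omega> z / bar \<omega> z) < 1)}"

definition HB_closed :: "(complex \<Rightarrow> complex) set" where
  "HB_closed = {\<omega>. entire \<omega> \<and> (\<forall>z. Im z < 0 \<longrightarrow> \<omega> z \<noteq> 0) \<and>
                    (\<forall>z. Im z > 0 \<longrightarrow> norm (\<omega> z / bar \<omega> z) \<le> 1)}"

lemma bar_real_parts:
  assumes "entire P" "entire Q" "real_function P" "real_function Q"
    and "\<And>z. \<omega> z = P z + \<i> * Q z"
  shows "bar \<omega> z = P z - \<i> * Q z"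
proof -
  have *: "cnj (f (cnj z)) = f z" if "entire f" "real_function f" for f :: "complex \<Rightarrow> complex"
  proof -
    have "(\<lambda>z. cnj (f (cnj z))) holomorphic_on UNIV"
      using holomorphic_on_compose_cnj_cnj[of f UNIV] that(1)
      by (simp add: entire_def o_def holomorphic_on_subset)
    then have hol: "(\<lambda>z. cnj (f (cnj z)) - f z) holomorphic_on UNIV"
      using that(1) by (auto simp: entire_def intro!: holomorphic_intros)
    have lim: "(0::complex) islimpt \<real>"
      unfolding islimpt_approachable
    proof (intro allI impI)
      fix e :: real
      assume "e > 0"
      then show "\<exists>x'\<in>\<real>. x' \<noteq> 0 \<and> dist x' (0::complex) < e"
        by (intro bexI[of _ "of_real (e / 2)"]) (auto simp: dist_norm)
    qed
    have "cnj (f (cnj w)) - f w = 0" if "w \<in> \<real>" for w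
      using that \<open>real_function f\<close>
      by (metis Reals_cases Reals_cnj_iff diff_self real_function_def)
    then have "cnj (f (cnj z)) - f z = 0"
      using analytic_continuation[OF hol _ _ _ _ lim, of z] by auto
    then show ?thesis by simp
  qed
  show ?thesis
    using assms *[of P] *[of Q] by (simp add: bar_def)
qed

end

theory Submission
  imports Defs
begin

text \<open>
  Write \<open>h z = exp (-\<i>\<tau>) * \<omega> z * exp (-\<i>\<sigma>z)\<close>. On the real axis the hypothesis says
  \<open>Re h \<ge> 0\<close>. Multiplication by \<open>exp (-\<i>\<sigma>z)\<close> cancels exactly the growth that \<open>\<omega>\<close> may have in
  the lower half-plane, so that \<open>h z = o(z)\<close> there, and the Phragmen-Lindelof principle applied to
  \<open>exp (-h)\<close> extends \<open>Re h \<ge> 0\<close> to the whole lower half-plane. Such functions \<open>\<omega>\<close> form the class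
  \<open>tilted_positive\<close>, in which the phase \<open>exp (-\<i>\<tau>)\<close> is replaced by an arbitrary unimodular constant
  \<open>a\<close>. Everything follows from four properties of this class.
  
  \<^item> Its members other than \<open>0\<close> have no zeros in the open lower half-plane, since a nonconstant
    holomorphic function with nonnegative real part omits \<open>0\<close>.
  
  \<^item> They satisfy \<open>\<bar>\<omega> (cnj z)\<bar> \<le> \<bar>\<omega> z\<bar>\<close> in the lower half-plane. This is the Phragmen-Lindelof
    principle for \<open>\<theta> = bar \<omega> / \<omega>\<close>, which is unimodular on the real axis; adding
    \<open>\<epsilon> * cnj a * exp (\<i>\<sigma>z)\<close> with \<open>\<epsilon> > 0\<close> to \<open>\<omega>\<close> keeps the denominator away from \<open>0\<close>
    (\<open>tilted_positive_reflection_le\<close>).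
  
  \<^item> A holomorphic function that vanishes at a real point and has nonnegative real part below it
    has a simple zero there or vanishes identically, because at a zero of order \<open>n\<close> the argument runs through an
    interval of length \<open>n\<pi>\<close> (\<open>deriv_nonzero_if_Re_nonneg_below\<close>). Applied to \<open>h\<close>, this shows that real
    zeros of \<open>\<omega>\<close> are simple. Applied to \<open>1 - \<theta> / \<theta> x\<close>, it shows that \<open>\<theta>' x \<noteq> 0\<close>, and \<open>\<theta>'\<close> is
    \<open>-2\<i> * d / \<omega>\<^sup>2\<close>. At a zero of \<open>\<omega>\<close> a factor \<open>z - x\<close> is divided out first, which accounts for
    the multiplicity \<open>2\<close>.
  
  \<^item> The class is closed under differentiation, with the phase turned by \<open>-\<i>\<close>
    (\<open>tilted_positive_deriv\<close>). It is closed under shifts \<open>\<omega> (z - \<i>c)\<close> with \<open>c \<ge> 0\<close>, so \<open>\<bar>\<omega>\<bar>\<close> does not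
    decrease downwards in the lower half-plane, which gives \<open>Im (\<omega>' / \<omega>) \<ge> 0\<close>. It is also closed under adding
    \<open>\<mu> * cnj a * exp (\<i>\<sigma>z)\<close> with \<open>Re \<mu> \<ge> 0\<close>. The inequality \<open>Im (\<omega>' / \<omega>) \<ge> 0\<close> for all these
    perturbations at once forces \<open>Re (-\<i> * a * \<omega>' * exp (-\<i>\<sigma>z)) \<ge> 0\<close>, a form of the Gauss-Lucas
    argument.
  
  Finally \<open>\<omega>'\<close> has no real zeros, by the third property. If \<open>\<omega>'\<close> were a constant times a real
  function, positivity would force it to change sign along with a cosine and hence to vanish somewhere
  on the real axis. So \<open>\<omega>'\<close> is again not real up to a constant factor, the maximum principle makes
  \<open>\<bar>\<omega>' (cnj z)\<bar> \<le> \<bar>\<omega>' z\<bar>\<close> strict, and the argument can be repeated for all derivatives.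
\<close>

section \<open>Phragmen-Lindelof principles\<close>

lemma le_if_le_mult_exp:
  fixes a b N :: real
  assumes "\<And>\<epsilon>. \<epsilon> > 0 \<Longrightarrow> a \<le> N * exp (\<epsilon> * b)"
  shows "a \<le> N"
proof (rule tendsto_lowerbound)
  have "((\<lambda>\<epsilon>. N * exp (\<epsilon> * b)) \<longlongrightarrow> N * exp (0 * b)) (at_right 0)"
    by (intro tendsto_intros)
  then show "((\<lambda>\<epsilon>. N * exp (\<epsilon> * b)) \<longlongrightarrow> N) (at_right 0)"
    by simp
  show "\<forall>\<^sub>F \<epsilon> in at_right 0. a \<le> N * exp (\<epsilon> * b)"
    using assms by (auto simp: eventually_at_right_less eventually_at_topological
        intro!: exI[of _ UNIV])
qed simp

text \<open>
  The maximum principle on the part of \<open>D\<close> in a large disc: the circular part of its boundary lies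
  where the bound is assumed.
\<close>

lemma maximum_modulus_unbounded:
  fixes f :: "complex \<Rightarrow> complex"
  assumes hol: "f holomorphic_on D" and "closed D"
    and frontier: "\<And>z. z \<in> frontier D \<Longrightarrow> norm (f z) \<le> M"
    and far: "\<And>z. z \<in> D \<Longrightarrow> norm z \<ge> R \<Longrightarrow> norm (f z) \<le> M"
    and "z \<in> D"
  shows "norm (f z) \<le> M"
proof -
  define S where "S = D \<inter> cball 0 (max R (norm z + 1))"
  have "closed S"
    using \<open>closed D\<close> by (auto simp: S_def)
  show ?thesis
  proof (rule maximum_modulus_frontier[of f S])
    show "f holomorphic_on interior S"
      using hol by (rule holomorphic_on_subset) (use interior_subset S_def in blast)
    show "continuous_on (closure S) f"
      using holomorphic_on_imp_continuous_on[OF hol] \<open>closed S\<close>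
      by (auto simp: S_def intro: continuous_on_subset)
    show "bounded S"
      by (auto simp: S_def)
    show "z \<in> S"
      using \<open>z \<in> D\<close> by (auto simp: S_def)
    fix w assume w: "w \<in> frontier S"
    then have "w \<in> S"
      using \<open>closed S\<close> frontier_subset_closed by blast
    moreover have "w \<in> frontier D \<or> w \<in> frontier (cball 0 (max R (norm z + 1)))"
      using frontier_Int_subset w unfolding S_def by blast
    ultimately show "norm (f w) \<le> M"
      using frontier far by (auto simp: S_def)
  qed
qed

text \<open>
  For \<open>u = a + \<i>b\<close> the conclusion reads \<open>Re (u ^ 3) \<ge> \<bar>u\<bar> ^ 3 / 4\<close>, and the hypotheses put \<open>u\<close> within
  the angle \<open>\<pi>/8\<close> of the positive axis.
\<close>

lemma Re_cube_ge:
  fixes a b :: real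
  assumes "a > 0" and "a\<^sup>2 - b\<^sup>2 \<ge> \<bar>2 * a * b\<bar>"
  shows "a * (a\<^sup>2 - 3 * b\<^sup>2) \<ge> (a\<^sup>2 + b\<^sup>2) * sqrt (a\<^sup>2 + b\<^sup>2) / 4"
proof -
  define c where "c = \<bar>b\<bar>"
  have bc: "b\<^sup>2 = c\<^sup>2" "c \<ge> 0"
    by (auto simp: c_def)
  have "a\<^sup>2 - c\<^sup>2 \<ge> 2 * a * c"
    using assms by (simp add: c_def abs_mult)
  have "a \<ge> 2 * c"
  proof (rule ccontr)
    assume "\<not> ?thesis"
    then have *: "a < 2 * c" by simp
    have "a * a < 2 * c * a"
      using * assms(1) by (intro mult_strict_right_mono) auto
    then show False
      using \<open>a\<^sup>2 - c\<^sup>2 \<ge> 2 * a * c\<close> zero_le_power2[of c] unfolding power2_eq_square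
      by (simp add: mult_ac)
  qed
  then have "2 * c * (2 * c) \<le> a * (2 * c)" 
    using bc by (intro mult_right_mono) auto
  then have 5: "5 * c\<^sup>2 \<le> a\<^sup>2"
    using \<open>a\<^sup>2 - c\<^sup>2 \<ge> 2 * a * c\<close> by (simp add: power2_eq_square algebra_simps)
  moreover have "0 \<le> c\<^sup>2"
    by simp
  ultimately have "a\<^sup>2 + c\<^sup>2 \<le> 25 / 16 * a\<^sup>2"
    by linarith
  then have "a\<^sup>2 + b\<^sup>2 \<le> (5 / 4 * a)\<^sup>2"
    by (simp add: bc power_mult_distrib power_divide)
  then have "sqrt (a\<^sup>2 + b\<^sup>2) \<le> 5 / 4 * a"
    using assms(1) by (intro real_le_lsqrt) auto
  moreover have "a\<^sup>2 + b\<^sup>2 \<le> 6 / 5 * a\<^sup>2"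
    using 5 bc by simp
  ultimately have "(a\<^sup>2 + b\<^sup>2) * sqrt (a\<^sup>2 + b\<^sup>2) \<le> (6 / 5 * a\<^sup>2) * (5 / 4 * a)"
    by (intro mult_mono) (use assms(1) in auto)
  also have "\<dots> \<le> 4 * (a * (2 / 5 * a\<^sup>2))"
    using assms(1) by simp
  also have "\<dots> \<le> 4 * (a * (a\<^sup>2 - 3 * b\<^sup>2))"
    using 5 bc assms(1) by (intro mult_left_mono) auto
  finally show ?thesis by simp
qed

text \<open>
  The function \<open>w * csqrt w\<close> is \<open>w\<close> to the power \<open>3/2\<close>. On the sector \<open>\<bar>Im w\<bar> \<le> Re w\<close>, of opening
  \<open>\<pi>/2\<close>, its argument is at most \<open>3\<pi>/8\<close>, so its real part is comparable to its modulus and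
  dominates every linear function of \<open>\<bar>w\<bar>\<close>.
\<close>

lemma Re_mult_csqrt_ge:
  assumes "Re w > 0" and "\<bar>Im w\<bar> \<le> Re w"
  shows "Re (w * csqrt w) \<ge> norm w * sqrt (norm w) / 4"
proof -
  define u where "u = csqrt w"
  have w: "w = u\<^sup>2"
    by (simp add: u_def)
  have re: "Re w = (Re u)\<^sup>2 - (Im u)\<^sup>2" and im: "Im w = 2 * Re u * Im u"
    by (simp_all add: w power2_eq_square)
  have "Re u \<ge> 0"
    using csqrt_principal[of w] by (auto simp: u_def)
  moreover have "Re u \<noteq> 0"
    using assms(1) re by (auto simp: power2_eq_square not_less)
  ultimately have "Re u > 0" by simp
  have nw: "norm w = (Re u)\<^sup>2 + (Im u)\<^sup>2"
    by (simp add: w norm_power cmod_power2)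
  have "Re (w * csqrt w) = Re u * ((Re u)\<^sup>2 - 3 * (Im u)\<^sup>2)"
    unfolding u_def[symmetric] by (simp add: re im power2_eq_square algebra_simps)
  then show ?thesis
    using Re_cube_ge[OF \<open>Re u > 0\<close>, of "Im u"] assms(2) nw re im by simp
qed

lemma frontier_first_quadrant:
  "frontier {z. 0 \<le> Re z \<and> 0 \<le> Im z} \<subseteq> {z. Re z = 0 \<or> Im z = 0}"
proof -
  have "open {z. 0 < Re z \<and> 0 < Im z}"
    by (intro open_Collect_conj open_halfspace_Re_gt open_halfspace_Im_gt)
  then have "{z. 0 < Re z \<and> 0 < Im z} \<subseteq> interior {z. 0 \<le> Re z \<and> 0 \<le> Im z}"
    by (intro interior_maximal) auto
  moreover have "closed {z. 0 \<le> Re z \<and> 0 \<le> Im z}"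
    by (intro closed_Collect_conj closed_halfspace_Re_ge closed_halfspace_Im_ge)
  ultimately show ?thesis
    by (force simp: frontier_def)
qed

text \<open>
  A quadrant admits growth of every order below \<open>2\<close>. The exponential growth of \<open>g\<close> is beaten by
  \<open>exp (- \<delta> * \<phi>)\<close>, where \<open>\<phi>\<close> has order \<open>3/2\<close>, and then \<open>\<delta>\<close> tends to \<open>0\<close>.
\<close>

lemma phragmen_lindelof_quadrant:
  assumes hol: "g holomorphic_on {z. 0 \<le> Re z \<and> 0 \<le> Im z}"
    and edges: "\<And>z. 0 \<le> Re z \<Longrightarrow> 0 \<le> Im z \<Longrightarrow> Re z = 0 \<or> Im z = 0 \<Longrightarrow> norm (g z) \<le> N"
    and growth: "\<And>z. 0 \<le> Re z \<Longrightarrow> 0 \<le> Im z \<Longrightarrow> norm (g z) \<le> C * exp (B * norm z)"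
    and "N > 0" and z: "0 \<le> Re z" "0 \<le> Im z"
  shows "norm (g z) \<le> N"
proof -
  define D where "D = {z. 0 \<le> Re z \<and> 0 \<le> Im z}"
  have "closed D"
    unfolding D_def by (intro closed_Collect_conj closed_halfspace_Re_ge closed_halfspace_Im_ge)
  \<comment> \<open>The factor \<open>1 - \<i>\<close> turns the first quadrant into the sector around the positive axis; adding
      \<open>1\<close> keeps the branch point of the square root out of the closed sector.\<close>
  define w where "w = (\<lambda>z. 1 + (1 - \<i>) * z)"
  have Re_w: "Re (w z) > 0" and Im_w: "\<bar>Im (w z)\<bar> \<le> Re (w z)" if "z \<in> D" for z
    using that by (auto simp: w_def D_def)
  have norm_w: "norm z \<le> norm (w z)" if "z \<in> D" for z
    using that by (auto simp: w_def D_def cmod_def power2_eq_square algebra_simps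
        intro!: real_sqrt_le_mono)
  define \<phi> where "\<phi> = (\<lambda>z. w z * csqrt (w z))"
  have hol_\<phi>: "\<phi> holomorphic_on D"
    unfolding \<phi>_def w_def
    by (intro holomorphic_intros) (use Re_w in \<open>auto simp: w_def complex_nonpos_Reals_iff\<close>, force)
  have Re_\<phi>: "norm z * sqrt (norm z) / 4 \<le> Re (\<phi> z)" if "z \<in> D" for z
  proof -
    have "norm z * sqrt (norm z) \<le> norm (w z) * sqrt (norm (w z))"
      using norm_w[OF that] by (intro mult_mono) auto
    then show ?thesis
      using Re_mult_csqrt_ge[OF Re_w[OF that] Im_w[OF that]] by (simp add: \<phi>_def)
  qed
  show ?thesis
  proof (rule le_if_le_mult_exp)
    fix \<delta> :: real assume "\<delta> > 0"
    define G where "G = (\<lambda>z. g z * exp (- of_real \<delta> * \<phi> z))"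
    have norm_G: "norm (G z) = norm (g z) * exp (- \<delta> * Re (\<phi> z))" for z
      by (simp add: G_def norm_mult)
    define C' where "C' = max C N"
    define R where "R = max (ln (C' / N)) ((4 * (\<bar>B\<bar> + 1) / \<delta>)\<^sup>2)"
    have "norm (G z) \<le> N"
    proof (rule maximum_modulus_unbounded[of G D])
      show "G holomorphic_on D"
        unfolding G_def by (intro holomorphic_intros hol_\<phi> hol[folded D_def])
      show "z \<in> D" using z by (simp add: D_def)
      fix z assume "z \<in> frontier D"
      then have "z \<in> D" "Re z = 0 \<or> Im z = 0"
        using frontier_first_quadrant frontier_subset_closed[OF \<open>closed D\<close>] by (auto simp: D_def)
      then have "norm (g z) \<le> N"
        using edges by (auto simp: D_def)
      moreover have "0 \<le> norm z * sqrt (norm z) / 4"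
        by simp
      then have "0 \<le> Re (\<phi> z)"
        using Re_\<phi>[OF \<open>z \<in> D\<close>] by linarith
      then have "exp (- \<delta> * Re (\<phi> z)) \<le> 1"
        using \<open>\<delta> > 0\<close> by simp
      ultimately have "norm (g z) * exp (- \<delta> * Re (\<phi> z)) \<le> N * 1"
        using \<open>N > 0\<close> by (intro mult_mono) auto
      then show "norm (G z) \<le> N"
        using norm_G by simp
    next
      fix z assume "z \<in> D" "R \<le> norm z"
      have "4 * (\<bar>B\<bar> + 1) / \<delta> \<le> sqrt (norm z)"
        using \<open>R \<le> norm z\<close> by (intro real_le_rsqrt) (simp add: R_def)
      then have "(\<bar>B\<bar> + 1) * norm z \<le> \<delta> * (norm z * sqrt (norm z) / 4)"
        using \<open>\<delta> > 0\<close> mult_right_mono[of "4 * (\<bar>B\<bar> + 1)" "\<delta> * sqrt (norm z)" "norm z"]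
        by (simp add: field_simps)
      also have "\<dots> \<le> \<delta> * Re (\<phi> z)"
        using Re_\<phi>[OF \<open>z \<in> D\<close>] \<open>\<delta> > 0\<close> by (intro mult_left_mono) auto
      finally have 1: "(\<bar>B\<bar> + 1) * norm z \<le> \<delta> * Re (\<phi> z)" .
      have "B * norm z \<le> \<bar>B\<bar> * norm z"
        by (intro mult_right_mono) auto
      then have 2: "B * norm z - \<delta> * Re (\<phi> z) \<le> - norm z"
        using 1 by (simp add: algebra_simps)
      have "norm (g z) \<le> C' * exp (B * norm z)"
        using growth[of z] \<open>z \<in> D\<close> by (auto simp: D_def C'_def intro: order_trans)
      then have "norm (G z) \<le> C' * exp (B * norm z) * exp (- \<delta> * Re (\<phi> z))"
        unfolding norm_G by (intro mult_right_mono) auto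
      also have "\<dots> = C' * exp (B * norm z - \<delta> * Re (\<phi> z))"
        by (simp add: exp_diff exp_minus field_simps)
      also have "\<dots> \<le> C' * exp (- norm z)"
        using 2 \<open>N > 0\<close> by (intro mult_left_mono) (auto simp: C'_def)
      also have "\<dots> \<le> C' * exp (- ln (C' / N))"
        using \<open>R \<le> norm z\<close> \<open>N > 0\<close> by (intro mult_left_mono) (auto simp: C'_def R_def)
      also have "\<dots> = N"
        using \<open>N > 0\<close> by (simp add: C'_def exp_minus)
      finally show "norm (G z) \<le> N" .
    qed (fact \<open>closed D\<close>)
    then show "norm (g z) \<le> N * exp (\<delta> * Re (\<phi> z))"
      unfolding norm_G by (simp add: exp_minus field_simps)
  qed
qed

text \<open>
  In \<open>g ^ n / (z - \<i>)\<close> the denominator makes the function small at infinity, while taking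
  \<open>n\<close>-th roots as \<open>n\<close> grows removes its effect on the bound.
\<close>

lemma phragmen_lindelof_bounded:
  assumes hol: "g holomorphic_on {z. Im z \<le> 0}"
    and real_axis: "\<And>x::real. norm (g (of_real x)) \<le> M"
    and bounded: "\<And>z. Im z \<le> 0 \<Longrightarrow> norm (g z) \<le> N"
    and "M > 0" and z: "Im z \<le> 0"
  shows "norm (g z) \<le> M"
proof (rule ccontr)
  assume "\<not> ?thesis"
  then have "norm (g z) / M > 1"
    using \<open>M > 0\<close> by simp
  then obtain n where n: "norm (z - \<i>) < (norm (g z) / M) ^ n"
    using real_arch_pow by blast
  have off: "1 \<le> norm (w - \<i>)" if "Im w \<le> 0" for w
    using abs_Im_le_cmod[of "w - \<i>"] that by simp
  define G where "G = (\<lambda>w. g w ^ n / (w - \<i>))"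
  have "norm (G z) \<le> M ^ n"
  proof (rule maximum_modulus_unbounded[of G "{z. Im z \<le> 0}"])
    show "G holomorphic_on {z. Im z \<le> 0}"
      unfolding G_def by (intro holomorphic_intros hol) auto
    show "closed {z. Im z \<le> 0}"
      by (rule closed_halfspace_Im_le)
    show "z \<in> {z. Im z \<le> 0}" using z by simp
    fix w :: complex assume "w \<in> frontier {z. Im z \<le> 0}"
    then have "Im w = 0"
      using frontier_halfspace_le[of \<i> 0] by (simp add: inner_complex_def)
    then have "norm (g w) \<le> M"
      using real_axis[of "Re w"] by (simp add: complex_is_Real_iff)
    then have "norm (g w) ^ n / norm (w - \<i>) \<le> M ^ n / 1"
      using \<open>M > 0\<close> off[of w] \<open>Im w = 0\<close> by (intro frac_le power_mono) auto
    then show "norm (G w) \<le> M ^ n"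
      by (simp add: G_def norm_divide norm_power)
  next
    fix w :: complex assume w: "w \<in> {z. Im z \<le> 0}" "1 + (N / M) ^ n \<le> norm w"
    have "norm w \<le> norm (w - \<i>) + norm \<i>"
      by (metis diff_add_cancel norm_triangle_ineq)
    then have "(N / M) ^ n \<le> norm (w - \<i>)"
      using w by simp
    then have "N ^ n \<le> M ^ n * norm (w - \<i>)"
      using \<open>M > 0\<close> by (simp add: power_divide field_simps)
    moreover have "norm (g w) ^ n \<le> N ^ n"
      using bounded w by (intro power_mono) auto
    ultimately have "norm (g w) ^ n / norm (w - \<i>) \<le> M ^ n"
      using off[of w] w \<open>M > 0\<close> by (simp add: divide_le_eq)
    then show "norm (G w) \<le> M ^ n"
      by (simp add: G_def norm_divide norm_power)
  qed
  then have "norm (g z) ^ n \<le> M ^ n * norm (z - \<i>)"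
    using off[OF z] by (auto simp: G_def norm_divide norm_power divide_le_eq split: if_splits)
  then have "(norm (g z) / M) ^ n \<le> norm (z - \<i>)"
    using \<open>M > 0\<close> by (simp add: power_divide field_simps)
  then show False
    using n by simp
qed

text \<open>
  In a half-plane, growth of order \<open>1\<close> is exactly critical, so the type along the imaginary axis has
  to be controlled as well. With the factor \<open>exp (-\<i>\<epsilon>z)\<close> the function is bounded on that axis, hence
  in both quadrants, hence in the half-plane.
\<close>

lemma phragmen_lindelof_half_plane:
  assumes hol: "g holomorphic_on {z. Im z \<le> 0}"
    and growth: "\<And>z. Im z \<le> 0 \<Longrightarrow> norm (g z) \<le> C * exp (B * norm z)"
    and ray: "\<And>\<epsilon>. \<epsilon> > 0 \<Longrightarrow> \<exists>K. \<forall>y\<ge>0. norm (g (- \<i> * of_real y)) \<le> K * exp (\<epsilon> * y)"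
    and real_axis: "\<And>x::real. norm (g (of_real x)) \<le> M"
    and "M > 0" and z: "Im z \<le> 0"
  shows "norm (g z) \<le> M"
proof (rule le_if_le_mult_exp)
  fix \<epsilon> :: real assume "\<epsilon> > 0"
  define G where "G = (\<lambda>z. g z * exp (- \<i> * of_real \<epsilon> * z))"
  have norm_G: "norm (G z) = norm (g z) * exp (\<epsilon> * Im z)" for z
    by (simp add: G_def norm_mult)
  have G_le: "norm (G z) \<le> norm (g z)" if "Im z \<le> 0" for z
    using that \<open>\<epsilon> > 0\<close> by (simp add: norm_G mult_left_le mult_nonneg_nonpos)
  have hol_G: "G holomorphic_on {z. Im z \<le> 0}"
    unfolding G_def by (intro holomorphic_intros hol)
  obtain K where K: "\<And>y. y \<ge> 0 \<Longrightarrow> norm (g (- \<i> * of_real y)) \<le> K * exp (\<epsilon> * y)"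
    using ray[OF \<open>\<epsilon> > 0\<close>] by blast
  define N where "N = max M K"
  have "N > 0" using \<open>M > 0\<close> by (simp add: N_def)
  have on_real: "norm (G z) \<le> N" if "Im z = 0" for z
    using G_le[of z] real_axis[of "Re z"] that by (auto simp: N_def complex_is_Real_iff)
  have on_ray: "norm (G z) \<le> N" if "Re z = 0" "Im z \<le> 0" for z
  proof -
    have "z = - \<i> * of_real (- Im z)"
      using that by (simp add: complex_eq_iff)
    then have "norm (g z) \<le> K * exp (\<epsilon> * - Im z)"
      using K[of "- Im z"] that by simp
    then have "norm (G z) \<le> K * exp (\<epsilon> * - Im z) * exp (\<epsilon> * Im z)"
      unfolding norm_G by (intro mult_right_mono) auto
    then show ?thesis
      by (simp add: mult.assoc N_def le_max_iff_disj flip: exp_add)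
  qed
  have growth_G: "norm (G z) \<le> C * exp (B * norm z)" if "Im z \<le> 0" for z
    using G_le[OF that] growth[OF that] by simp
  have "norm (G z) \<le> N" if "Im z \<le> 0" for z
  proof (cases "Re z \<ge> 0")
    case True
    have "norm (G (- \<i> * (\<i> * z))) \<le> N"
    proof (rule phragmen_lindelof_quadrant[where g = "\<lambda>w. G (- \<i> * w)"])
      show "(\<lambda>w. G (- \<i> * w)) holomorphic_on {z. 0 \<le> Re z \<and> 0 \<le> Im z}"
        by (rule holomorphic_on_compose_gen[OF _ hol_G, unfolded o_def])
          (auto intro!: holomorphic_intros)
      show "norm (G (- \<i> * w)) \<le> C * exp (B * norm w)" if "0 \<le> Re w" "0 \<le> Im w" for w
        using growth_G[of "- \<i> * w"] that by (simp add: norm_mult)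
    qed (use True that \<open>N > 0\<close> on_real on_ray in auto)
    then show ?thesis by (simp add: mult.assoc[symmetric])
  next
    case False
    have "norm (G (- (- z))) \<le> N"
    proof (rule phragmen_lindelof_quadrant[where g = "\<lambda>w. G (- w)"])
      show "(\<lambda>w. G (- w)) holomorphic_on {z. 0 \<le> Re z \<and> 0 \<le> Im z}"
        by (rule holomorphic_on_compose_gen[OF _ hol_G, unfolded o_def])
          (auto intro!: holomorphic_intros)
      show "norm (G (- w)) \<le> C * exp (B * norm w)" if "0 \<le> Re w" "0 \<le> Im w" for w
        using growth_G[of "- w"] that by simp
    qed (use False that \<open>N > 0\<close> on_real on_ray in auto)
    then show ?thesis by simp
  qed
  moreover have "norm (G (of_real x)) \<le> M" for x
    using G_le[of "of_real x"] real_axis[of x] by simp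
  ultimately have "norm (G z) \<le> M"
    by (intro phragmen_lindelof_bounded[OF hol_G _ _ \<open>M > 0\<close> z])
  then show "norm (g z) \<le> M * exp (\<epsilon> * - Im z)"
    unfolding norm_G by (simp add: exp_minus field_simps)
qed

lemma phragmen_lindelof_minimal_type:
  assumes hol: "g holomorphic_on {z. Im z \<le> 0}"
    and growth: "\<And>\<epsilon>. \<epsilon> > 0 \<Longrightarrow> \<exists>C. \<forall>z. Im z \<le> 0 \<longrightarrow> norm (g z) \<le> C * exp (\<epsilon> * norm z)"
    and real_axis: "\<And>x::real. norm (g (of_real x)) \<le> M"
    and "M > 0" and z: "Im z \<le> 0"
  shows "norm (g z) \<le> M"
proof -
  obtain C where C: "\<And>z. Im z \<le> 0 \<Longrightarrow> norm (g z) \<le> C * exp (1 * norm z)"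
    using growth[of 1] by auto
  show ?thesis
  proof (rule phragmen_lindelof_half_plane[OF hol C])
    fix \<epsilon> :: real assume "\<epsilon> > 0"
    then obtain K where K: "\<And>z. Im z \<le> 0 \<Longrightarrow> norm (g z) \<le> K * exp (\<epsilon> * norm z)"
      using growth[of \<epsilon>] by auto
    have "norm (g (- \<i> * of_real y)) \<le> K * exp (\<epsilon> * y)" if "y \<ge> 0" for y
      using K[of "- \<i> * of_real y"] that by (simp add: norm_mult)
    then show "\<exists>K. \<forall>y\<ge>0. norm (g (- \<i> * of_real y)) \<le> K * exp (\<epsilon> * y)"
      by blast
  qed (use real_axis \<open>M > 0\<close> z in auto)
qed

text \<open>
  \<open>Re h \<ge> 0\<close> means \<open>\<bar>exp (-h)\<bar> \<le> 1\<close>, and \<open>h z = o(z)\<close> makes \<open>exp (-h)\<close> of minimal type.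
\<close>

lemma Re_nonneg_lower_half_plane:
  assumes hol: "h holomorphic_on {z. Im z \<le> 0}"
    and growth: "\<And>\<epsilon>. \<epsilon> > 0 \<Longrightarrow> \<exists>C. \<forall>z. Im z \<le> 0 \<longrightarrow> norm (h z) \<le> \<epsilon> * norm z + C"
    and real_axis: "\<And>x::real. Re (h (of_real x)) \<ge> 0"
    and z: "Im z \<le> 0"
  shows "Re (h z) \<ge> 0"
proof -
  have "norm (exp (- h z)) \<le> 1"
  proof (rule phragmen_lindelof_minimal_type[where g = "\<lambda>z. exp (- h z)"])
    show "(\<lambda>z. exp (- h z)) holomorphic_on {z. Im z \<le> 0}"
      by (intro holomorphic_intros hol)
    fix \<epsilon> :: real assume "\<epsilon> > 0"
    then obtain C where C: "\<And>z. Im z \<le> 0 \<Longrightarrow> norm (h z) \<le> \<epsilon> * norm z + C"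
      using growth[of \<epsilon>] by blast
    have "norm (exp (- h z)) \<le> exp C * exp (\<epsilon> * norm z)" if "Im z \<le> 0" for z
    proof -
      have "- Re (h z) \<le> C + \<epsilon> * norm z"
        using abs_Re_le_cmod[of "h z"] C[OF that] by linarith
      then show ?thesis
        by (simp flip: exp_add)
    qed
    then show "\<exists>C. \<forall>z. Im z \<le> 0 \<longrightarrow> norm (exp (- h z)) \<le> C * exp (\<epsilon> * norm z)"
      by blast
  qed (use real_axis z in auto)
  then show ?thesis by simp
qed

section \<open>Growth in the half-planes\<close>

text \<open>
  In \<open>f z * exp (-\<i>\<sigma>z) / (z - \<i>A)\<close> the exponential removes the growth along the imaginary axis, and
  the denominator with a large \<open>A\<close> brings the bound on the real axis down to \<open>\<epsilon>\<close>.
\<close>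

lemma half_plane_growth:
  assumes entire: "entire f" and "\<sigma> > 0"
    and type: "\<And>\<epsilon>. \<epsilon> > 0 \<Longrightarrow> \<exists>A. \<forall>z. norm (f z) \<le> A * exp ((\<sigma> + \<epsilon>) * norm z)"
    and real_axis: "\<And>\<epsilon>. \<epsilon> > 0 \<Longrightarrow> \<exists>C. \<forall>x::real. norm (f (of_real x)) \<le> \<epsilon> * \<bar>x\<bar> + C"
    and "\<epsilon> > 0"
  shows "\<exists>C. \<forall>z. Im z \<le> 0 \<longrightarrow> norm (f z) \<le> (\<epsilon> * norm z + C) * exp (\<sigma> * \<bar>Im z\<bar>)"
proof -
  obtain C where C: "\<And>x::real. norm (f (of_real x)) \<le> \<epsilon> / 2 * \<bar>x\<bar> + C"
    using real_axis[of "\<epsilon> / 2"] \<open>\<epsilon> > 0\<close> by auto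
  define A where "A = max 1 (2 * C / \<epsilon>)"
  have "A \<ge> 1" "C \<le> \<epsilon> / 2 * A"
    using \<open>\<epsilon> > 0\<close> by (auto simp: A_def field_simps max_def)
  define g where "g = (\<lambda>z. f z * exp (- \<i> * of_real \<sigma> * z) / (z - \<i> * of_real A))"
  have norm_g: "norm (g z) = norm (f z) * exp (\<sigma> * Im z) / norm (z - \<i> * of_real A)" for z
    by (simp add: g_def norm_mult norm_divide)
  have off: "A \<le> norm (z - \<i> * of_real A)" if "Im z \<le> 0" for z
    using abs_Im_le_cmod[of "z - \<i> * of_real A"] that \<open>A \<ge> 1\<close> by simp
  have g_le: "norm (g z) \<le> norm (f z) * exp (\<sigma> * Im z)" if "Im z \<le> 0" for z
    unfolding norm_g using off[OF that] \<open>A \<ge> 1\<close> 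
    using frac_le[of "norm (f z) * exp (\<sigma> * Im z)" "norm (f z) * exp (\<sigma> * Im z)" 1]
    by simp
  obtain K where K: "\<And>z. norm (f z) \<le> K * exp ((\<sigma> + 1) * norm z)"
    using type[of 1] by auto
  have g_bound: "norm (g z) \<le> \<epsilon>" if z: "Im z \<le> 0" for z
  proof (rule phragmen_lindelof_half_plane[where g = g])
    show "g holomorphic_on {z. Im z \<le> 0}"
      unfolding g_def
    proof (intro holomorphic_intros)
      show "f holomorphic_on {z. Im z \<le> 0}"
        using entire by (auto simp: entire_def intro: holomorphic_on_subset)
      show "z - \<i> * of_real A \<noteq> 0" if "z \<in> {z. Im z \<le> 0}" for z
        using off[of z] that \<open>A \<ge> 1\<close> by auto
    qed
    show "norm (g z) \<le> K * exp ((\<sigma> + 1) * norm z)" if "Im z \<le> 0" for z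
    proof -
      have "norm (f z) * exp (\<sigma> * Im z) \<le> norm (f z)"
        using that \<open>\<sigma> > 0\<close> by (simp add: mult_left_le mult_nonneg_nonpos)
      then show ?thesis
        using g_le[OF that] K[of z] by linarith
    qed
  next
    fix \<delta> :: real assume "\<delta> > 0"
    then obtain K where K: "\<And>z. norm (f z) \<le> K * exp ((\<sigma> + \<delta>) * norm z)"
      using type by blast
    have "norm (g (- \<i> * of_real y)) \<le> K * exp (\<delta> * y)" if "y \<ge> 0" for y
    proof -
      have "norm (g (- \<i> * of_real y)) \<le> norm (f (- \<i> * of_real y)) * exp (\<sigma> * - y)"
        using g_le[of "- \<i> * of_real y"] that by simp
      also have "\<dots> \<le> K * exp ((\<sigma> + \<delta>) * y) * exp (\<sigma> * - y)"
        using K[of "- \<i> * of_real y"] that by (intro mult_right_mono) (auto simp: norm_mult)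
      also have "\<dots> = K * exp (\<delta> * y)"
        by (simp add: mult.assoc algebra_simps flip: exp_add)
      finally show ?thesis .
    qed
    then show "\<exists>K. \<forall>y\<ge>0. norm (g (- \<i> * of_real y)) \<le> K * exp (\<delta> * y)"
      by blast
  next
    fix x :: real
    have "\<bar>x\<bar> \<le> norm (of_real x - \<i> * of_real A)"
      using abs_Re_le_cmod[of "of_real x - \<i> * of_real A"] by simp
    then have "\<bar>x\<bar> + A \<le> 2 * norm (of_real x - \<i> * of_real A)"
      using off[of "of_real x"] by simp
    then have "\<epsilon> / 2 * (\<bar>x\<bar> + A) \<le> \<epsilon> / 2 * (2 * norm (of_real x - \<i> * of_real A))"
      using \<open>\<epsilon> > 0\<close> by (intro mult_left_mono) auto
    moreover have "norm (f (of_real x)) \<le> \<epsilon> / 2 * (\<bar>x\<bar> + A)"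
      using C[of x] \<open>C \<le> \<epsilon> / 2 * A\<close> by (simp add: algebra_simps)
    ultimately have "norm (f (of_real x)) \<le> \<epsilon> * norm (of_real x - \<i> * of_real A)"
      by simp
    moreover have "norm (of_real x - \<i> * of_real A) > 0"
      using off[of "of_real x"] \<open>A \<ge> 1\<close> by simp
    ultimately show "norm (g (of_real x)) \<le> \<epsilon>"
      unfolding norm_g by (simp add: divide_le_eq)
  qed (use z \<open>\<epsilon> > 0\<close> in auto)
  have "norm (f z) \<le> (\<epsilon> * norm z + \<epsilon> * A) * exp (\<sigma> * \<bar>Im z\<bar>)" if "Im z \<le> 0" for z
  proof -
    have pos: "norm (z - \<i> * of_real A) > 0"
      using off[OF that] \<open>A \<ge> 1\<close> by linarith
    have "norm (z - \<i> * of_real A) \<le> norm z + A"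
      using norm_triangle_ineq4[of z "\<i> * of_real A"] \<open>A \<ge> 1\<close> by (simp add: norm_mult)
    then have "\<epsilon> * norm (z - \<i> * of_real A) \<le> \<epsilon> * (norm z + A)"
      using \<open>\<epsilon> > 0\<close> by (intro mult_left_mono) auto
    then have "norm (f z) * exp (\<sigma> * Im z) \<le> \<epsilon> * (norm z + A)"
      using g_bound[OF that] pos unfolding norm_g by (simp add: divide_le_eq)
    then have "norm (f z) * exp (\<sigma> * Im z) * exp (- \<sigma> * Im z) \<le> \<epsilon> * (norm z + A) * exp (- \<sigma> * Im z)"
      by (intro mult_right_mono) auto
    then show ?thesis
      using that by (simp add: mult.assoc algebra_simps flip: exp_add)
  qed
  then show ?thesis by blast
qed

text \<open>
  The growth that type at most \<open>\<sigma>\<close> and \<open>f x = o(x)\<close> on the real axis entail. In this form it is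
  uniform over the plane and passes to shifts and derivatives.
\<close>

definition sublinear_type :: "real \<Rightarrow> (complex \<Rightarrow> complex) \<Rightarrow> bool" where
  "sublinear_type \<sigma> f \<longleftrightarrow>
     (\<forall>\<epsilon>>0. \<exists>C. \<forall>z. norm (f z) \<le> (\<epsilon> * norm z + C) * exp (\<sigma> * \<bar>Im z\<bar>))"

lemma sublinear_typeI:
  assumes entire: "entire f" and "\<sigma> > 0"
    and type: "\<And>\<epsilon>. \<epsilon> > 0 \<Longrightarrow> \<exists>A. \<forall>z. norm (f z) \<le> A * exp ((\<sigma> + \<epsilon>) * norm z)"
    and real_axis: "\<And>\<epsilon>. \<epsilon> > 0 \<Longrightarrow> \<exists>C. \<forall>x::real. norm (f (of_real x)) \<le> \<epsilon> * \<bar>x\<bar> + C"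
  shows "sublinear_type \<sigma> f"
  unfolding sublinear_type_def
proof (intro allI impI)
  fix \<epsilon> :: real assume "\<epsilon> > 0"
  obtain C where C: "\<And>z. Im z \<le> 0 \<Longrightarrow> norm (f z) \<le> (\<epsilon> * norm z + C) * exp (\<sigma> * \<bar>Im z\<bar>)"
    using half_plane_growth[OF assms \<open>\<epsilon> > 0\<close>] by blast
  have entire': "entire (\<lambda>z. f (- z))"
    unfolding entire_def using holomorphic_on_compose_gen[of "\<lambda>z. - z" UNIV f UNIV] entire
    by (auto simp: entire_def o_def holomorphic_on_minus[OF holomorphic_on_ident])
  have type': "\<exists>A. \<forall>z. norm (f (- z)) \<le> A * exp ((\<sigma> + \<delta>) * norm z)" if "\<delta> > 0" for \<delta>
    using type[OF that] by (metis norm_minus_cancel)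
  have real_axis': "\<exists>C. \<forall>x::real. norm (f (- of_real x)) \<le> \<delta> * \<bar>x\<bar> + C" if "\<delta> > 0" for \<delta>
    using real_axis[OF that] by (metis abs_minus_cancel of_real_minus)
  obtain C' where C': "\<And>z. Im z \<le> 0 \<Longrightarrow> norm (f (- z)) \<le> (\<epsilon> * norm z + C') * exp (\<sigma> * \<bar>Im z\<bar>)"
    using half_plane_growth[OF entire' \<open>\<sigma> > 0\<close> type' real_axis' \<open>\<epsilon> > 0\<close>] by blast
  have "norm (f z) \<le> (\<epsilon> * norm z + max C C') * exp (\<sigma> * \<bar>Im z\<bar>)" for z
  proof -
    have "norm (f z) \<le> (\<epsilon> * norm z + C) * exp (\<sigma> * \<bar>Im z\<bar>) \<or>
          norm (f z) \<le> (\<epsilon> * norm z + C') * exp (\<sigma> * \<bar>Im z\<bar>)"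
      using C[of z] C'[of "- z"] by (cases "Im z \<le> 0") auto
    moreover have "(\<epsilon> * norm z + D) * exp (\<sigma> * \<bar>Im z\<bar>) \<le> (\<epsilon> * norm z + max C C') * exp (\<sigma> * \<bar>Im z\<bar>)"
      if "D \<le> max C C'" for D
      using that by (intro mult_right_mono) auto
    ultimately show ?thesis
      by (meson max.cobounded1 max.cobounded2 order_trans)
  qed
  then show "\<exists>C. \<forall>z. norm (f z) \<le> (\<epsilon> * norm z + C) * exp (\<sigma> * \<bar>Im z\<bar>)"
    by blast
qed

section \<open>Boundary zeros of functions with nonnegative real part\<close>

text \<open>
  Near a zero of order \<open>n\<close> the function is close to \<open>\<kappa> * (z - x) ^ n\<close>, so \<open>Re (\<kappa> * u ^ n) \<ge> 0\<close> for
  all downward directions \<open>u\<close>. For \<open>n \<ge> 2\<close> the values \<open>u ^ n\<close> do not fit into a half-plane.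
\<close>

lemma deriv_nonzero_if_Re_nonneg_below:
  fixes x :: real
  assumes hol: "g holomorphic_on ball (of_real x) r" and "r > 0"
    and "g (of_real x) = 0" and nonconst: "\<not> g constant_on ball (of_real x) r"
    and Re_nonneg: "\<And>z. z \<in> ball (of_real x) r \<Longrightarrow> Im z < 0 \<Longrightarrow> Re (g z) \<ge> 0"
  shows "deriv g (of_real x) \<noteq> 0"
proof -
  obtain k \<rho> n where "n > 0" "\<rho> > 0" and \<rho>: "ball (complex_of_real x) \<rho> \<subseteq> ball (of_real x) r"
    and hol_k: "k holomorphic_on ball (of_real x) \<rho>"
    and g_eq: "\<And>w. w \<in> ball (of_real x) \<rho> \<Longrightarrow> g w = (w - of_real x) ^ n * k w"
    and k_nz: "\<And>w. w \<in> ball (of_real x) \<rho> \<Longrightarrow> k w \<noteq> 0"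
    by (rule holomorphic_factor_zero_nonconstant[OF hol open_ball connected_ball
          _ \<open>g (of_real x) = 0\<close> nonconst]) (simp add: \<open>r > 0\<close>, rule that)
  define \<kappa> where "\<kappa> = k (of_real x)"
  have "\<kappa> \<noteq> 0"
    using k_nz \<open>\<rho> > 0\<close> by (simp add: \<kappa>_def)
  have isCont: "isCont k (of_real x)"
    using hol_k \<open>\<rho> > 0\<close> by (intro holomorphic_on_imp_continuous_on[THEN continuous_on_interior]) auto
  have dir: "Re (u ^ n * \<kappa>) \<ge> 0" if "Im u < 0" "norm u = 1" for u
  proof (rule tendsto_lowerbound)
    have "((\<lambda>t. of_real x + of_real t * u) \<longlongrightarrow> of_real x + of_real 0 * u) (at_right 0)"
      by (intro tendsto_intros)
    then have "((\<lambda>t. k (of_real x + of_real t * u)) \<longlongrightarrow> \<kappa>) (at_right 0)"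
      unfolding \<kappa>_def by (intro isCont_tendsto_compose[OF isCont]) simp
    then show "((\<lambda>t. Re (u ^ n * k (of_real x + of_real t * u))) \<longlongrightarrow> Re (u ^ n * \<kappa>)) (at_right 0)"
      by (intro tendsto_intros)
    have "0 \<le> Re (u ^ n * k (of_real x + of_real t * u))" if t: "0 < t" "t < \<rho>" for t
    proof -
      define w where "w = of_real x + of_real t * u"
      have w: "w \<in> ball (of_real x) \<rho>"
        using t \<open>norm u = 1\<close> by (simp add: w_def dist_norm norm_mult)
      have "Im w < 0"
        using t \<open>Im u < 0\<close> by (simp add: w_def mult_pos_neg)
      then have "0 \<le> Re (g w)"
        using Re_nonneg w \<rho> by blast
      also have "g w = of_real (t ^ n) * (u ^ n * k w)"
        using g_eq[OF w] by (simp add: w_def power_mult_distrib)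
      finally have "0 \<le> t ^ n * Re (u ^ n * k w)"
        by simp
      moreover have "0 < t ^ n"
        using t by simp
      ultimately show ?thesis
        unfolding zero_le_mult_iff w_def by (meson not_le)
    qed
    then show "\<forall>\<^sub>F t in at_right 0. 0 \<le> Re (u ^ n * k (of_real x + of_real t * u))"
      using \<open>\<rho> > 0\<close> eventually_at_right_less[of 0] eventually_at_right_field by blast
  qed simp
  have "n = 1"
  proof (rule ccontr)
    assume "n \<noteq> 1"
    then have "n \<ge> 2" using \<open>n > 0\<close> by simp
    define K where "K = (- \<i>) ^ n * \<kappa>"
    have rotated: "Re (cis (of_nat n * b) * K) \<ge> 0" if "\<bar>b\<bar> < pi / 2" for b
    proof -
      have "cos b > 0"
        using that by (intro cos_gt_zero_pi) auto
      then have "Re ((- \<i> * cis b) ^ n * \<kappa>) \<ge> 0"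
        by (intro dir) (auto simp: norm_mult)
      also have "(- \<i> * cis b) ^ n * \<kappa> = cis (of_nat n * b) * K"
        by (simp only: power_mult_distrib Complex.DeMoivre K_def mult.assoc mult.left_commute)
      finally show ?thesis .
    qed
    \<comment> \<open>The directions at angles \<open>0\<close>, \<open>b\<close> and \<open>-b\<close> from \<open>-\<i>\<close> suffice: their \<open>n\<close>-th powers are turned
        by \<open>0\<close> and by \<open>3\<pi>/4\<close> both ways, and \<open>b < \<pi>/2\<close> because of \<open>n \<ge> 2\<close>.\<close>
    define b where "b = 3 * pi / (4 * of_nat n)"
    have "b \<le> 3 * pi / (4 * of_nat 2)"
      unfolding b_def using \<open>n \<ge> 2\<close> by (intro divide_left_mono mult_left_mono) auto
    then have "b \<le> 3 / 8 * pi"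
      by simp
    then have "b < pi / 2"
      using pi_gt_zero by linarith
    moreover have "b \<ge> 0"
      by (simp add: b_def)
    ultimately have b: "\<bar>b\<bar> < pi / 2" "\<bar>- b\<bar> < pi / 2"
      by auto
    have nb: "of_nat n * b = 3 * pi / 4"
      using \<open>n \<ge> 2\<close> by (simp add: b_def)
    have sin: "sin (3 * pi / 4) > 0"
      by (intro sin_gt_zero) auto
    have "cos (3 * pi / 4) = cos (pi / 4 + pi / 2)"
      by (rule arg_cong[of _ _ cos]) simp
    also have "\<dots> < 0"
      unfolding cos_add by (simp add: sin_45)
    finally have cos: "cos (3 * pi / 4) < 0" .
    define c s where "c = cos (3 * pi / 4)" and "s = sin (3 * pi / 4)"
    have plus: "0 \<le> c * Re K - s * Im K" and minus: "0 \<le> c * Re K + s * Im K"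
      using rotated[OF b(1)] rotated[OF b(2)] nb by (auto simp: c_def s_def)
    have "0 \<le> Re K"
      using rotated[of 0] by simp
    moreover have "c * Re K \<ge> 0"
      using plus minus by linarith
    ultimately have "Re K = 0"
      using cos by (auto simp: c_def zero_le_mult_iff)
    moreover from this have "s * Im K = 0"
      using plus minus by simp
    ultimately have "K = 0"
      using sin by (simp add: s_def complex_eq_iff)
    then show False
      using \<open>\<kappa> \<noteq> 0\<close> by (simp add: K_def)
  qed
  have "(k has_field_derivative deriv k (of_real x)) (at (of_real x))"
    using hol_k \<open>\<rho> > 0\<close> by (intro holomorphic_derivI[of _ "ball (of_real x) \<rho>"]) auto
  then have "((\<lambda>w. (w - of_real x) * k w) has_field_derivative \<kappa>) (at (of_real x))"
    unfolding \<kappa>_def by (auto intro!: derivative_eq_intros)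
  then have "(g has_field_derivative \<kappa>) (at (of_real x))"
    by (rule has_field_derivative_transform_within_open[of _ _ _ "ball (of_real x) \<rho>"])
      (use \<open>\<rho> > 0\<close> g_eq \<open>n = 1\<close> in auto)
  then show ?thesis
    using \<open>\<kappa> \<noteq> 0\<close> by (simp add: DERIV_imp_deriv)
qed

section \<open>Reflection in the real axis and the Wronskian\<close>

lemma bar_of_real [simp]: "bar f (of_real x) = cnj (f (of_real x))"
  by (simp add: bar_def)

lemma norm_bar: "norm (bar f z) = norm (f (cnj z))"
  by (simp add: bar_def)

lemma has_field_derivative_bar:
  assumes "entire f"
  shows "(bar f has_field_derivative bar (deriv f) z) (at z)"
proof -
  have "(f has_field_derivative deriv f (cnj z)) (at (cnj z))"
    using assms by (auto simp: entire_def intro: holomorphic_derivI)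
  then have "(cnj \<circ> f \<circ> cnj has_field_derivative bar (deriv f) z) (at z)"
    unfolding bar_def by (rule has_field_derivative_cnj_cnj)
  moreover have "bar f = cnj \<circ> f \<circ> cnj"
    by (simp add: fun_eq_iff bar_def)
  ultimately show ?thesis
    by simp
qed

lemma deriv_bar: "entire f \<Longrightarrow> deriv (bar f) = bar (deriv f)"
  by (rule ext, rule DERIV_imp_deriv, rule has_field_derivative_bar)

lemma entire_bar: "entire f \<Longrightarrow> entire (bar f)"
  unfolding entire_def[of "bar f"] holomorphic_on_open[OF open_UNIV]
  using has_field_derivative_bar by blast

lemma entire_deriv: "entire f \<Longrightarrow> entire (deriv f)"
  by (auto simp: entire_def intro: holomorphic_deriv)

lemma entire_DERIV: "entire f \<Longrightarrow> (f has_field_derivative deriv f z) (at z)"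
  by (auto simp: entire_def intro: holomorphic_derivI)

lemma entire_eqI:
  assumes "entire f" "entire g" "open U" "U \<noteq> {}" "\<And>z. z \<in> U \<Longrightarrow> f z = g z"
  shows "f z = g z"
  by (rule analytic_continuation_open[of U UNIV f g]) (use assms in \<open>auto simp: entire_def\<close>)

text \<open>
  Here \<open>c\<close> must be unimodular unless \<open>f\<close> vanishes, and multiplying \<open>f\<close> by a square root of \<open>c\<close> makes it
  real.
\<close>

lemma real_up_to_constantI:
  assumes "entire f" and eq: "\<And>z. bar f z = c * f z"
  shows "real_up_to_constant f"
proof (cases "\<forall>z. f z = 0")
  case True
  have "entire (\<lambda>_. 0)" "real_function (\<lambda>_. 0)"
    by (auto simp: entire_def real_function_def)
  then show ?thesis
    unfolding real_up_to_constant_def using True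
    by (intro exI[of _ 0] exI[of _ "\<lambda>_. 0"]) auto
next
  case False
  then obtain z where z: "f z \<noteq> 0" by blast
  have "norm (f (cnj z)) = norm c * norm (f z)" "norm (f z) = norm c * norm (f (cnj z))"
    using eq[of z] eq[of "cnj z"] norm_bar[of f] by (metis norm_mult complex_cnj_cnj)+
  then have "norm (f z) = norm c * norm c * norm (f z)"
    by simp
  then have "norm c * norm c = 1"
    using z by simp
  define b where "b = csqrt c"
  have c: "c = b * b"
    by (simp add: b_def power2_eq_square flip: power2_eq_square)
  have "norm b ^ 4 = 1"
    using \<open>norm c * norm c = 1\<close> by (simp add: c norm_mult power4_eq_xxxx mult_ac)
  then have "norm b = 1"
    using power_eq_imp_eq_base[of "norm b" 4 1] by simp
  then have b: "cnj b * b = 1"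
    by (metis complex_cnj_mult complex_norm_square mult.commute of_real_1 power_one)
  define g where "g = (\<lambda>z. b * f z)"
  have "cnj (g (of_real x)) = g (of_real x)" for x :: real
  proof -
    have "cnj (g (of_real x)) = cnj b * (c * f (of_real x))"
      using eq[of "of_real x"] by (simp add: g_def)
    also have "\<dots> = (cnj b * b) * (b * f (of_real x))"
      by (simp add: c)
    finally show ?thesis
      by (simp only: b g_def mult_1)
  qed
  then have "real_function g"
    by (simp add: real_function_def Reals_cnj_iff)
  moreover have "entire g"
    using \<open>entire f\<close> by (auto simp: entire_def g_def intro!: holomorphic_intros)
  moreover have "f z = cnj b * g z" for z
    by (simp add: g_def b flip: mult.assoc)
  ultimately show ?thesis
    unfolding real_up_to_constant_def by blast
qed

text \<open>
  Let \<open>\<theta> = bar f / f\<close>, a function bounded by \<open>1\<close> in the lower half-plane and unimodular at the real point \<open>x\<close>.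
  Then \<open>1 - \<theta> / \<theta> x\<close> vanishes at \<open>x\<close> and has nonnegative real part below, so \<open>\<theta>\<close> has nonzero derivative
  at \<open>x\<close>; the numerator of that derivative is the Wronskian up to sign.
\<close>

lemma wronskian_nonzero:
  fixes x :: real
  assumes "entire f" and dom: "\<And>z. Im z \<le> 0 \<Longrightarrow> norm (f (cnj z)) \<le> norm (f z)"
    and "f (of_real x) \<noteq> 0" and "\<not> real_up_to_constant f"
  shows "bar f (of_real x) * deriv f (of_real x) - deriv (bar f) (of_real x) * f (of_real x) \<noteq> 0"
proof -
  define \<theta> where "\<theta> = (\<lambda>z. bar f z / f z)"
  define u where "u = \<theta> (of_real x)"
  have norm_u: "norm u = 1"
    using assms(3) by (simp add: u_def \<theta>_def norm_divide)
  then have "u \<noteq> 0"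
    by auto
  have "isCont f (of_real x)"
    using entire_DERIV[OF \<open>entire f\<close>] DERIV_isCont by blast
  then obtain r where "r > 0" and f_nz: "\<And>z. z \<in> ball (of_real x) r \<Longrightarrow> f z \<noteq> 0"
    using continuous_at_avoid[of "of_real x" f 0] assms(3) by auto
  have hol: "\<theta> holomorphic_on ball (of_real x) r"
    unfolding \<theta>_def using \<open>entire f\<close> entire_bar[OF \<open>entire f\<close>] f_nz
    by (intro holomorphic_intros) (auto simp: entire_def intro: holomorphic_on_subset)
  define g where "g = (\<lambda>z. 1 - \<theta> z / u)"
  have hol_g: "g holomorphic_on ball (of_real x) r"
    unfolding g_def using norm_u by (intro holomorphic_intros hol) auto
  have g_x: "g (of_real x) = 0"
    using norm_u by (auto simp: g_def u_def)
  have "\<not> g constant_on ball (of_real x) r"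
  proof
    assume "g constant_on ball (of_real x) r"
    then have g_0: "g z = 0" if "z \<in> ball (of_real x) r" for z
      using that g_x \<open>r > 0\<close> unfolding constant_on_def by (metis centre_in_ball)
    have "bar f z = u * f z" if "z \<in> ball (of_real x) r" for z
    proof -
      have "\<theta> z / u = 1"
        using g_0[OF that] by (simp add: g_def)
      then have "\<theta> z = u"
        using \<open>u \<noteq> 0\<close> by simp
      then show ?thesis
        using f_nz[OF that] by (simp add: \<theta>_def field_simps)
    qed
    moreover have "entire (\<lambda>z. u * f z)"
      using \<open>entire f\<close> unfolding entire_def by (intro holomorphic_intros)
    ultimately have "bar f z = u * f z" for z
      using \<open>r > 0\<close> entire_eqI[OF entire_bar[OF \<open>entire f\<close>], of _ "ball (of_real x) r"] by simp
    then show False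
      using real_up_to_constantI[OF \<open>entire f\<close>, of u] assms(4) by blast
  qed
  moreover have "Re (g z) \<ge> 0" if z: "z \<in> ball (of_real x) r" "Im z < 0" for z
  proof -
    have "norm (\<theta> z / u) \<le> 1"
      using dom[of z] z f_nz[OF z(1)] norm_u by (simp add: \<theta>_def norm_divide norm_mult norm_bar)
    then show ?thesis
      using complex_Re_le_cmod[of "\<theta> z / u"] by (simp add: g_def)
  qed
  ultimately have g'_nz: "deriv g (of_real x) \<noteq> 0"
    using deriv_nonzero_if_Re_nonneg_below[OF hol_g \<open>r > 0\<close> g_x] by blast
  have "((\<lambda>z. 1 - bar f z / f z / u) has_field_derivative
      - ((deriv (bar f) (of_real x) * f (of_real x) - bar f (of_real x) * deriv f (of_real x))
          / (f (of_real x) * f (of_real x))) / u) (at (of_real x))"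
    using assms(3) \<open>u \<noteq> 0\<close>
    by (auto intro!: derivative_eq_intros entire_DERIV[OF \<open>entire f\<close>]
        entire_DERIV[OF entire_bar[OF \<open>entire f\<close>]]) (auto simp: field_simps)
  then show ?thesis
    using g'_nz by (auto simp: g_def \<theta>_def dest!: DERIV_imp_deriv)
qed

text \<open>
  With \<open>f z = (z - x) * g z\<close>, the Wronskian of \<open>f\<close> is \<open>(z - x)\<^sup>2\<close> times the Wronskian of \<open>g\<close>. The function
  \<open>g\<close> inherits the hypotheses of \<open>wronskian_nonzero\<close>, because the removed factor is real on the real
  axis.
\<close>

lemma zorder_wronskian_at_simple_zero:
  fixes x :: real
  assumes "entire f" and dom: "\<And>z. Im z \<le> 0 \<Longrightarrow> norm (f (cnj z)) \<le> norm (f z)"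
    and f_x: "f (of_real x) = 0" and f'_x: "deriv f (of_real x) \<noteq> 0"
    and "\<not> real_up_to_constant f"
  shows "zorder (\<lambda>z. bar f z * deriv f z - deriv (bar f) z * f z) (of_real x) = 2"
proof -
  define g where "g = (\<lambda>z. if z = of_real x then deriv f (of_real x)
                           else (f z - f (of_real x)) / (z - of_real x))"
  have "entire g"
    using pole_lemma[of f UNIV "of_real x"] \<open>entire f\<close> by (simp add: entire_def g_def)
  have f_eq: "f = (\<lambda>z. (z - of_real x) * g z)"
    by (auto simp: g_def f_x fun_eq_iff)
  have bar_f_eq: "bar f = (\<lambda>z. (z - of_real x) * bar g z)"
    by (subst f_eq) (simp add: bar_def fun_eq_iff)
  have f': "deriv f z = g z + (z - of_real x) * deriv g z" for z
    by (rule DERIV_imp_deriv, subst f_eq)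
      (auto intro!: derivative_eq_intros entire_DERIV[OF \<open>entire g\<close>])
  have bar_f': "deriv (bar f) z = bar g z + (z - of_real x) * deriv (bar g) z" for z
    by (rule DERIV_imp_deriv, subst bar_f_eq)
      (auto intro!: derivative_eq_intros entire_DERIV[OF entire_bar[OF \<open>entire g\<close>]])
  define W where "W = (\<lambda>z. bar g z * deriv g z - deriv (bar g) z * g z)"
  have "\<not> real_up_to_constant g"
  proof
    assume "real_up_to_constant g"
    then obtain c k where k: "entire k" "real_function k" "\<And>z. g z = c * k z"
      by (auto simp: real_up_to_constant_def)
    have "entire (\<lambda>z. (z - of_real x) * k z)" "real_function (\<lambda>z. (z - of_real x) * k z)"
      using k by (auto simp: entire_def real_function_def intro!: holomorphic_intros)
    moreover have "f z = c * ((z - of_real x) * k z)" for z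
      by (subst f_eq) (simp add: k(3))
    ultimately show False
      using assms(5) unfolding real_up_to_constant_def by blast
  qed
  moreover have dom_g: "norm (g (cnj z)) \<le> norm (g z)" if "Im z \<le> 0" for z
  proof (cases "z = of_real x")
    case False
    have "norm (f w) = norm (w - of_real x) * norm (g w)" for w
      by (subst f_eq) (simp add: norm_mult)
    moreover have "norm (cnj z - of_real x) = norm (z - of_real x)"
      by (metis complex_cnj_complex_of_real complex_cnj_diff complex_mod_cnj)
    ultimately show ?thesis
      using dom[OF that] False by simp
  qed simp
  moreover have "g (of_real x) \<noteq> 0"
    using f'_x by (simp add: g_def)
  ultimately have "W (of_real x) \<noteq> 0"
    unfolding W_def by (intro wronskian_nonzero \<open>entire g\<close>)
  moreover have "W holomorphic_on UNIV"
    using \<open>entire g\<close> entire_bar[OF \<open>entire g\<close>] unfolding W_def entire_def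
    by (intro holomorphic_intros) auto
  moreover have "bar f z * deriv f z - deriv (bar f) z * f z = W z * (z - of_real x) powi 2" for z
    unfolding f' bar_f' W_def
    by (subst f_eq, subst bar_f_eq) (simp add: power2_eq_square algebra_simps)
  ultimately show ?thesis
    by (intro zorder_eqI[of UNIV _ W]) auto
qed

section \<open>The class of functions with positive tilted real part\<close>

text \<open>
  The unimodular \<open>a\<close> is the phase \<open>exp (-\<i>\<tau>)\<close>. It is a parameter because differentiation turns it by
  \<open>-\<i>\<close>.
\<close>

definition tilted_positive :: "real \<Rightarrow> complex \<Rightarrow> (complex \<Rightarrow> complex) \<Rightarrow> bool" where
  "tilted_positive \<sigma> a f \<longleftrightarrow> entire f \<and> sublinear_type \<sigma> f \<and> norm a = 1 \<and>
     (\<forall>z. Im z \<le> 0 \<longrightarrow> Re (a * f z * exp (- \<i> * of_real \<sigma> * z)) \<ge> 0)"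

lemma tilted_positiveD:
  assumes "tilted_positive \<sigma> a f"
  shows "entire f" "sublinear_type \<sigma> f" "norm a = 1" "a * cnj a = 1"
    "Im z \<le> 0 \<Longrightarrow> Re (a * f z * exp (- \<i> * of_real \<sigma> * z)) \<ge> 0"
proof -
  show "a * cnj a = 1"
    using assms complex_norm_square[of a] by (simp add: tilted_positive_def)
qed (use assms in \<open>simp_all add: tilted_positive_def\<close>)

lemma tilted_positiveI:
  assumes "entire f" "sublinear_type \<sigma> f" "norm a = 1"
    and real_axis: "\<And>x::real. Re (a * f (of_real x) * exp (- \<i> * of_real \<sigma> * of_real x)) \<ge> 0"
  shows "tilted_positive \<sigma> a f"
  unfolding tilted_positive_def
proof (intro conjI assms allI impI)
  fix z :: complex assume "Im z \<le> 0"
  show "Re (a * f z * exp (- \<i> * of_real \<sigma> * z)) \<ge> 0"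
  proof (rule Re_nonneg_lower_half_plane[where h = "\<lambda>z. a * f z * exp (- \<i> * of_real \<sigma> * z)"])
    have "f holomorphic_on {z. Im z \<le> 0}"
      using \<open>entire f\<close> by (auto simp: entire_def intro: holomorphic_on_subset)
    then show "(\<lambda>z. a * f z * exp (- \<i> * of_real \<sigma> * z)) holomorphic_on {z. Im z \<le> 0}"
      by (intro holomorphic_intros)
    fix \<epsilon> :: real assume "\<epsilon> > 0"
    then obtain C where C: "\<And>z. norm (f z) \<le> (\<epsilon> * norm z + C) * exp (\<sigma> * \<bar>Im z\<bar>)"
      using \<open>sublinear_type \<sigma> f\<close> unfolding sublinear_type_def by blast
    have "norm (a * f z * exp (- \<i> * of_real \<sigma> * z)) \<le> \<epsilon> * norm z + C" if "Im z \<le> 0" for z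
    proof -
      have "norm (a * f z * exp (- \<i> * of_real \<sigma> * z)) = norm (f z) * exp (\<sigma> * Im z)"
        using \<open>norm a = 1\<close> by (simp add: norm_mult)
      also have "\<dots> \<le> (\<epsilon> * norm z + C) * exp (\<sigma> * \<bar>Im z\<bar>) * exp (\<sigma> * Im z)"
        using C[of z] by (intro mult_right_mono) auto
      also have "\<dots> = \<epsilon> * norm z + C"
        using that by (simp add: mult.assoc flip: exp_add)
      finally show ?thesis .
    qed
    then show "\<exists>C. \<forall>z. Im z \<le> 0 \<longrightarrow> norm (a * f z * exp (- \<i> * of_real \<sigma> * z)) \<le> \<epsilon> * norm z + C"
      by blast
  qed (use real_axis \<open>Im z \<le> 0\<close> in auto)
qed

text \<open>
  The added function contributes the constant \<open>\<mu>\<close> to \<open>a * f z * exp (-\<i>\<sigma>z)\<close>. Real \<open>\<mu> > 0\<close> keep this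
  quantity away from \<open>0\<close>; differentiation needs complex \<open>\<mu>\<close>.
\<close>

lemma tilted_positive_add_exp:
  assumes f: "tilted_positive \<sigma> a f" and "\<sigma> > 0" and "Re \<mu> \<ge> 0"
  shows "tilted_positive \<sigma> a (\<lambda>z. f z + \<mu> * cnj a * exp (\<i> * of_real \<sigma> * z))"
proof -
  note a = tilted_positiveD[OF f]
  have "entire (\<lambda>z. f z + \<mu> * cnj a * exp (\<i> * of_real \<sigma> * z))"
    using a(1) unfolding entire_def by (intro holomorphic_intros)
  moreover have "sublinear_type \<sigma> (\<lambda>z. f z + \<mu> * cnj a * exp (\<i> * of_real \<sigma> * z))"
    unfolding sublinear_type_def
  proof (intro allI impI)
    fix \<epsilon> :: real assume "\<epsilon> > 0"
    then obtain C where C: "\<And>z. norm (f z) \<le> (\<epsilon> * norm z + C) * exp (\<sigma> * \<bar>Im z\<bar>)"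
      using a(2) unfolding sublinear_type_def by blast
    have "norm (f z + \<mu> * cnj a * exp (\<i> * of_real \<sigma> * z))
        \<le> (\<epsilon> * norm z + (C + norm \<mu>)) * exp (\<sigma> * \<bar>Im z\<bar>)" for z
    proof -
      have "- (\<sigma> * Im z) \<le> \<sigma> * \<bar>Im z\<bar>"
        using \<open>\<sigma> > 0\<close> by (metis abs_ge_minus_self abs_mult abs_of_pos)
      then have "norm (\<mu> * cnj a * exp (\<i> * of_real \<sigma> * z)) \<le> norm \<mu> * exp (\<sigma> * \<bar>Im z\<bar>)"
        using a(3) by (simp add: norm_mult mult_left_mono)
      then have "norm (f z + \<mu> * cnj a * exp (\<i> * of_real \<sigma> * z))
          \<le> (\<epsilon> * norm z + C) * exp (\<sigma> * \<bar>Im z\<bar>) + norm \<mu> * exp (\<sigma> * \<bar>Im z\<bar>)"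
        using C[of z] by (intro norm_triangle_mono)
      then show ?thesis
        by (simp add: algebra_simps)
    qed
    then show "\<exists>C. \<forall>z. norm (f z + \<mu> * cnj a * exp (\<i> * of_real \<sigma> * z))
        \<le> (\<epsilon> * norm z + C) * exp (\<sigma> * \<bar>Im z\<bar>)"
      by blast
  qed
  moreover have "a * (f z + \<mu> * cnj a * exp (\<i> * of_real \<sigma> * z)) * exp (- \<i> * of_real \<sigma> * z)
      = a * f z * exp (- \<i> * of_real \<sigma> * z) + \<mu>" for z
  proof -
    have "a * (f z + \<mu> * cnj a * exp (\<i> * of_real \<sigma> * z)) * exp (- \<i> * of_real \<sigma> * z)
        = a * f z * exp (- \<i> * of_real \<sigma> * z)
          + \<mu> * (a * cnj a) * (exp (\<i> * of_real \<sigma> * z) * exp (- \<i> * of_real \<sigma> * z))"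
      by (simp only: algebra_simps)
    then show ?thesis
      by (simp add: a(4) flip: exp_add)
  qed
  ultimately show ?thesis
    using a(3,5) \<open>Re \<mu> \<ge> 0\<close> unfolding tilted_positive_def by simp
qed

lemma mult_add_le_shift:
  fixes \<epsilon> C D r s :: real
  assumes "0 \<le> \<epsilon>" "r \<le> s + D" shows "\<epsilon> * r + C \<le> \<epsilon> * s + (\<epsilon> * D + C)"
  using mult_left_mono[OF assms(2,1)] by (simp add: algebra_simps)

text \<open>
  A downward shift only multiplies \<open>exp (-\<i>\<sigma>z)\<close> by a positive constant.
\<close>

lemma tilted_positive_shift:
  assumes f: "tilted_positive \<sigma> a f" and "\<sigma> > 0" and "c \<ge> 0"
  shows "tilted_positive \<sigma> a (\<lambda>z. f (z - \<i> * of_real c))"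
proof -
  note a = tilted_positiveD[OF f]
  have "entire (\<lambda>z. f (z - \<i> * of_real c))"
    using holomorphic_on_compose_gen[of "\<lambda>z. z - \<i> * of_real c" UNIV f UNIV] a(1)
    by (simp add: entire_def o_def holomorphic_on_diff)
  moreover have "sublinear_type \<sigma> (\<lambda>z. f (z - \<i> * of_real c))"
    unfolding sublinear_type_def
  proof (intro allI impI)
    fix \<epsilon> :: real assume "\<epsilon> > 0"
    define \<delta> where "\<delta> = \<epsilon> / exp (\<sigma> * c)"
    have "\<delta> > 0" using \<open>\<epsilon> > 0\<close> by (simp add: \<delta>_def)
    then obtain C where C: "\<And>z. norm (f z) \<le> (\<delta> * norm z + C) * exp (\<sigma> * \<bar>Im z\<bar>)"
      using a(2) unfolding sublinear_type_def by blast
    have "norm (f (z - \<i> * of_real c)) \<le> (\<epsilon> * norm z + (\<delta> * c + C) * exp (\<sigma> * c)) * exp (\<sigma> * \<bar>Im z\<bar>)" for z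
    proof -
      have "norm (z - \<i> * of_real c) \<le> norm z + c"
        using norm_triangle_ineq4[of z "\<i> * of_real c"] \<open>c \<ge> 0\<close> by (simp add: norm_mult)
      then have 1: "\<delta> * norm (z - \<i> * of_real c) + C \<le> \<delta> * norm z + (\<delta> * c + C)"
        using \<open>\<delta> > 0\<close> by (intro mult_add_le_shift) auto
      have "\<bar>Im z - c\<bar> \<le> \<bar>Im z\<bar> + c"
        using \<open>c \<ge> 0\<close> by linarith
      then have "\<sigma> * \<bar>Im z - c\<bar> \<le> \<sigma> * (\<bar>Im z\<bar> + c)"
        using \<open>\<sigma> > 0\<close> by (intro mult_left_mono) auto
      then have 2: "exp (\<sigma> * \<bar>Im z - c\<bar>) \<le> exp (\<sigma> * c) * exp (\<sigma> * \<bar>Im z\<bar>)"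
        by (simp add: algebra_simps flip: exp_add)
      have C_nonneg: "0 \<le> \<delta> * norm (z - \<i> * of_real c) + C"
        using order_trans[OF norm_ge_zero C[of "z - \<i> * of_real c"]] by (simp add: zero_le_mult_iff)
      have "norm (f (z - \<i> * of_real c)) \<le> (\<delta> * norm (z - \<i> * of_real c) + C) * exp (\<sigma> * \<bar>Im z - c\<bar>)"
        using C[of "z - \<i> * of_real c"] by simp
      also have "\<dots> \<le> (\<delta> * norm z + (\<delta> * c + C)) * (exp (\<sigma> * c) * exp (\<sigma> * \<bar>Im z\<bar>))"
        using 1 2 C_nonneg by (intro mult_mono) auto
      also have "\<dots> = (\<epsilon> * norm z + (\<delta> * c + C) * exp (\<sigma> * c)) * exp (\<sigma> * \<bar>Im z\<bar>)"
        by (simp add: \<delta>_def field_simps)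
      finally show ?thesis .
    qed
    then show "\<exists>C. \<forall>z. norm (f (z - \<i> * of_real c)) \<le> (\<epsilon> * norm z + C) * exp (\<sigma> * \<bar>Im z\<bar>)"
      by blast
  qed
  moreover have "Re (a * f (z - \<i> * of_real c) * exp (- \<i> * of_real \<sigma> * z)) \<ge> 0" if "Im z \<le> 0" for z
  proof -
    define w where "w = z - \<i> * of_real c"
    have "exp (- \<i> * of_real \<sigma> * z) = of_real (exp (\<sigma> * c)) * exp (- \<i> * of_real \<sigma> * w)"
      unfolding w_def by (simp add: exp_of_real[symmetric] algebra_simps flip: exp_add)
    then have "a * f w * exp (- \<i> * of_real \<sigma> * z)
        = of_real (exp (\<sigma> * c)) * (a * f w * exp (- \<i> * of_real \<sigma> * w))"
      by (simp only: mult_ac)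
    then have "Re (a * f w * exp (- \<i> * of_real \<sigma> * z))
        = exp (\<sigma> * c) * Re (a * f w * exp (- \<i> * of_real \<sigma> * w))"
      by (simp only: times_complex.sel Re_complex_of_real Im_complex_of_real mult_zero_left diff_zero)
    moreover have "Re (a * f w * exp (- \<i> * of_real \<sigma> * w)) \<ge> 0"
      using that \<open>c \<ge> 0\<close> by (intro a(5)) (simp add: w_def)
    ultimately show ?thesis
      by (simp add: w_def)
  qed
  ultimately show ?thesis
    using a(3) unfolding tilted_positive_def by blast
qed

text \<open>
  Cauchy estimate on discs of radius \<open>1\<close>.
\<close>

lemma sublinear_type_deriv:
  assumes "entire f" "sublinear_type \<sigma> f" "\<sigma> > 0"
  shows "sublinear_type \<sigma> (deriv f)"
  unfolding sublinear_type_def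
proof (intro allI impI)
  fix \<epsilon> :: real assume "\<epsilon> > 0"
  define \<delta> where "\<delta> = \<epsilon> / exp \<sigma>"
  have "\<delta> > 0" using \<open>\<epsilon> > 0\<close> by (simp add: \<delta>_def)
  then obtain C where C: "\<And>z. norm (f z) \<le> (\<delta> * norm z + C) * exp (\<sigma> * \<bar>Im z\<bar>)"
    using assms(2) unfolding sublinear_type_def by blast
  have "norm (deriv f z) \<le> (\<epsilon> * norm z + (\<delta> * 1 + C) * exp \<sigma>) * exp (\<sigma> * \<bar>Im z\<bar>)" for z
  proof -
    have "norm ((deriv ^^ 1) f z) \<le> fact 1 * ((\<delta> * norm z + (\<delta> * 1 + C)) * (exp \<sigma> * exp (\<sigma> * \<bar>Im z\<bar>))) / 1 ^ 1"
    proof (rule Cauchy_inequality)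
      show "f holomorphic_on ball z 1" "continuous_on (cball z 1) f"
        using \<open>entire f\<close> by (auto simp: entire_def intro: holomorphic_on_subset
            holomorphic_on_imp_continuous_on)
      fix w assume w: "norm (z - w) = 1"
      have "norm w \<le> norm z + 1"
        using norm_triangle_sub[of w z] w by (simp add: norm_minus_commute)
      then have 1: "\<delta> * norm w + C \<le> \<delta> * norm z + (\<delta> * 1 + C)"
        using \<open>\<delta> > 0\<close> by (intro mult_add_le_shift) auto
      have "\<bar>Im w\<bar> \<le> \<bar>Im z\<bar> + 1"
        using abs_Im_le_cmod[of "z - w"] w by simp
      then have "\<sigma> * \<bar>Im w\<bar> \<le> \<sigma> * (\<bar>Im z\<bar> + 1)"
        using \<open>\<sigma> > 0\<close> by (intro mult_left_mono) auto
      then have 2: "exp (\<sigma> * \<bar>Im w\<bar>) \<le> exp \<sigma> * exp (\<sigma> * \<bar>Im z\<bar>)"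
        by (simp add: algebra_simps flip: exp_add)
      have "0 \<le> \<delta> * norm w + C"
        using order_trans[OF norm_ge_zero C[of w]] by (simp add: zero_le_mult_iff)
      then show "norm (f w) \<le> (\<delta> * norm z + (\<delta> * 1 + C)) * (exp \<sigma> * exp (\<sigma> * \<bar>Im z\<bar>))"
        using 1 2 by (intro order_trans[OF C] mult_mono) auto
    qed simp
    also have "\<dots> = (\<epsilon> * norm z + (\<delta> * 1 + C) * exp \<sigma>) * exp (\<sigma> * \<bar>Im z\<bar>)"
      by (simp add: \<delta>_def field_simps)
    finally show ?thesis
      by simp
  qed
  then show "\<exists>C. \<forall>z. norm (deriv f z) \<le> (\<epsilon> * norm z + C) * exp (\<sigma> * \<bar>Im z\<bar>)"
    by blast
qed

text \<open>
  The functions \<open>F = f + \<epsilon> * cnj a * exp (\<i>\<sigma>z)\<close> satisfy \<open>\<bar>F z\<bar> \<ge> \<epsilon> * exp (\<sigma> * \<bar>Im z\<bar>)\<close> in the lower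
  half-plane. So \<open>bar F / F\<close> grows at most linearly there, is unimodular on the real axis, and is
  therefore bounded by \<open>1\<close>. The claim for \<open>f\<close> is the limit \<open>\<epsilon> \<rightarrow> 0\<close>.
\<close>

lemma tilted_positive_reflection_le:
  assumes f: "tilted_positive \<sigma> a f" and "\<sigma> > 0" and z: "Im z \<le> 0"
  shows "norm (f (cnj z)) \<le> norm (f z)"
proof (rule field_le_epsilon)
  fix \<eta> :: real assume "\<eta> > 0"
  \<comment> \<open>The perturbation changes \<open>\<bar>f (cnj z)\<bar>\<close> and \<open>\<bar>f z\<bar>\<close> together by at most \<open>\<eta>\<close>.\<close>
  define \<epsilon> where "\<epsilon> = \<eta> / (exp (\<sigma> * Im z) + exp (- \<sigma> * Im z))"
  have den: "exp (\<sigma> * Im z) + exp (- \<sigma> * Im z) > 0"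
    by (simp add: add_pos_pos)
  then have "\<epsilon> > 0"
    using \<open>\<eta> > 0\<close> by (simp add: \<epsilon>_def)
  define F where "F = (\<lambda>z. f z + of_real \<epsilon> * cnj a * exp (\<i> * of_real \<sigma> * z))"
  have F: "tilted_positive \<sigma> a F"
    unfolding F_def using \<open>\<epsilon> > 0\<close> by (intro tilted_positive_add_exp f \<open>\<sigma> > 0\<close>) simp
  note a = tilted_positiveD[OF f]
  have norm_diff: "norm (F w - f w) = \<epsilon> * exp (- \<sigma> * Im w)" for w
    using a(3) \<open>\<epsilon> > 0\<close> by (simp add: F_def norm_mult)
  have F_ge: "\<epsilon> * exp (\<sigma> * \<bar>Im w\<bar>) \<le> norm (F w)" if "Im w \<le> 0" for w
  proof -
    have "a * F w * exp (- \<i> * of_real \<sigma> * w)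
        = a * f w * exp (- \<i> * of_real \<sigma> * w)
          + of_real \<epsilon> * (a * cnj a) * (exp (\<i> * of_real \<sigma> * w) * exp (- \<i> * of_real \<sigma> * w))"
      unfolding F_def by (simp only: algebra_simps)
    then have "a * F w * exp (- \<i> * of_real \<sigma> * w) = a * f w * exp (- \<i> * of_real \<sigma> * w) + of_real \<epsilon>"
      by (simp add: a(4) flip: exp_add)
    then have "\<epsilon> \<le> Re (a * F w * exp (- \<i> * of_real \<sigma> * w))"
      using a(5)[OF that] by simp
    also have "\<dots> \<le> norm (a * F w * exp (- \<i> * of_real \<sigma> * w))"
      by (rule complex_Re_le_cmod)
    also have "\<dots> = norm (F w) * exp (\<sigma> * Im w)"
      using a(3) by (simp add: norm_mult)
    finally have "\<epsilon> * exp (- \<sigma> * Im w) \<le> norm (F w) * exp (\<sigma> * Im w) * exp (- \<sigma> * Im w)"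
      by (intro mult_right_mono) auto
    then show ?thesis
      using that by (simp add: mult.assoc flip: exp_add)
  qed
  have F_nz: "F w \<noteq> 0" if "Im w \<le> 0" for w
    using F_ge[OF that] \<open>\<epsilon> > 0\<close> by (metis exp_gt_zero mult_pos_pos norm_zero not_le)
  define \<theta> where "\<theta> = (\<lambda>w. bar F w / F w)"
  obtain C where C: "\<And>w. norm (F w) \<le> (1 * norm w + C) * exp (\<sigma> * \<bar>Im w\<bar>)"
    using tilted_positiveD(2)[OF F] unfolding sublinear_type_def by (meson zero_less_one)
  have \<theta>_growth: "norm (\<theta> w) \<le> (norm w + C) / \<epsilon>" if "Im w \<le> 0" for w
  proof -
    have "norm (\<theta> w) = norm (F (cnj w)) / norm (F w)"
      by (simp add: \<theta>_def norm_divide norm_bar)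
    also have "\<dots> \<le> ((norm w + C) * exp (\<sigma> * \<bar>Im w\<bar>)) / (\<epsilon> * exp (\<sigma> * \<bar>Im w\<bar>))"
      using C[of "cnj w"] F_ge[OF that] \<open>\<epsilon> > 0\<close> order_trans[OF norm_ge_zero C[of "cnj w"]]
      by (intro frac_le) auto
    finally show ?thesis by simp
  qed
  have "norm (\<theta> z) \<le> 1"
  proof (rule phragmen_lindelof_minimal_type[where g = \<theta>])
    have "F holomorphic_on {z. Im z \<le> 0}" "bar F holomorphic_on {z. Im z \<le> 0}"
      using tilted_positiveD(1)[OF F] entire_bar
      by (auto simp: entire_def intro: holomorphic_on_subset)
    then show "\<theta> holomorphic_on {z. Im z \<le> 0}"
      unfolding \<theta>_def using F_nz by (intro holomorphic_intros) auto
    fix \<delta> :: real assume "\<delta> > 0"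
    have "norm (\<theta> w) \<le> (1 / \<delta> + \<bar>C\<bar>) / \<epsilon> * exp (\<delta> * norm w)" if "Im w \<le> 0" for w
    proof -
      have "\<delta> * norm w \<le> exp (\<delta> * norm w)"
        using exp_ge_add_one_self[of "\<delta> * norm w"] by linarith
      then have "norm w \<le> 1 / \<delta> * exp (\<delta> * norm w)"
        using \<open>\<delta> > 0\<close> by (simp add: field_simps)
      moreover have "\<bar>C\<bar> * 1 \<le> \<bar>C\<bar> * exp (\<delta> * norm w)"
        using \<open>\<delta> > 0\<close> by (intro mult_left_mono) auto
      ultimately have "norm w + C \<le> (1 / \<delta> + \<bar>C\<bar>) * exp (\<delta> * norm w)"
        by (simp add: distrib_right)
      then have "(norm w + C) / \<epsilon> \<le> (1 / \<delta> + \<bar>C\<bar>) * exp (\<delta> * norm w) / \<epsilon>"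
        using \<open>\<epsilon> > 0\<close> by (intro divide_right_mono) auto
      then show ?thesis
        using \<theta>_growth[OF that] by simp
    qed
    then show "\<exists>C. \<forall>z. Im z \<le> 0 \<longrightarrow> norm (\<theta> z) \<le> C * exp (\<delta> * norm z)"
      by blast
  qed (use z in \<open>auto simp: \<theta>_def norm_divide\<close>)
  then have "norm (F (cnj z)) \<le> norm (F z)"
    using F_nz[OF z] by (simp add: \<theta>_def norm_divide norm_bar divide_le_eq)
  moreover have "norm (f (cnj z)) \<le> norm (F (cnj z)) + \<epsilon> * exp (\<sigma> * Im z)"
    using norm_triangle_sub[of "f (cnj z)" "F (cnj z)"] norm_diff[of "cnj z"]
    by (simp add: norm_minus_commute)
  moreover have "norm (F z) \<le> norm (f z) + \<epsilon> * exp (- \<sigma> * Im z)"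
    using norm_triangle_sub[of "F z" "f z"] norm_diff[of z] by simp
  moreover have "\<epsilon> * exp (\<sigma> * Im z) + \<epsilon> * exp (- \<sigma> * Im z) = \<eta>"
    unfolding distrib_left[symmetric] using den by (simp add: \<epsilon>_def)
  ultimately show "norm (f (cnj z)) \<le> norm (f z) + \<eta>"
    by linarith
qed

section \<open>Zeros\<close>

text \<open>
  By the open mapping theorem a nonconstant \<open>h\<close> would take negative values near \<open>h w = 0\<close>.
\<close>

lemma constant_if_Re_nonneg_and_zero_below:
  assumes "entire h" and Re_nonneg: "\<And>z. Im z < 0 \<Longrightarrow> Re (h z) \<ge> 0"
    and "Im w < 0" "h w = 0"
  shows "h z = 0"
proof -
  have "h constant_on UNIV"
  proof (rule ccontr)
    assume "\<not> h constant_on UNIV"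
    then have "open (h ` {z. Im z < 0})"
      using open_mapping_thm[of h UNIV "{z. Im z < 0}"] \<open>entire h\<close>
      by (simp add: entire_def open_halfspace_Im_lt connected_UNIV)
    moreover have "0 \<in> h ` {z. Im z < 0}"
      using assms(3,4) by force
    ultimately obtain e where "e > 0" and e: "ball 0 e \<subseteq> h ` {z. Im z < 0}"
      by (meson openE)
    then have "of_real (- e / 2) \<in> h ` {z. Im z < 0}"
      by (intro subsetD[OF e]) (simp add: dist_norm)
    then obtain z where "Im z < 0" "h z = of_real (- e / 2)"
      by auto
    then show False
      using Re_nonneg[of z] \<open>e > 0\<close> by simp
  qed
  then show ?thesis
    using \<open>h w = 0\<close> by (auto simp: constant_on_def)
qed

lemma tilted_positive_zero_free:
  assumes f: "tilted_positive \<sigma> a f" and "\<not> real_up_to_constant f" and "Im w < 0"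
  shows "f w \<noteq> 0"
proof
  assume "f w = 0"
  note a = tilted_positiveD[OF f]
  define h where "h = (\<lambda>z. a * f z * exp (- \<i> * of_real \<sigma> * z))"
  have "entire h"
    using a(1) unfolding h_def entire_def by (intro holomorphic_intros)
  then have "h z = 0" for z
    by (rule constant_if_Re_nonneg_and_zero_below[of h w])
      (use a(5) \<open>f w = 0\<close> \<open>Im w < 0\<close> in \<open>auto simp: h_def\<close>)
  moreover have "a \<noteq> 0"
    using a(3) by auto
  ultimately have "f z = 0" for z
    by (simp add: h_def)
  then have "real_up_to_constant f"
    by (intro real_up_to_constantI[OF a(1), of 0]) (simp add: bar_def)
  then show False
    using assms(2) by contradiction
qed

lemma tilted_positive_simple_real_zero:
  fixes x :: real
  assumes f: "tilted_positive \<sigma> a f" and "\<not> real_up_to_constant f" and "f (of_real x) = 0"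
  shows "deriv f (of_real x) \<noteq> 0"
proof -
  note a = tilted_positiveD[OF f]
  define h where "h = (\<lambda>z. a * f z * exp (- \<i> * of_real \<sigma> * z))"
  have "entire h"
    using a(1) unfolding h_def entire_def by (intro holomorphic_intros)
  have "h (of_real x - \<i> / 2) \<noteq> 0" "h (of_real x) = 0"
    using tilted_positive_zero_free[OF f assms(2)] a(3) assms(3) by (auto simp: h_def)
  moreover have "of_real x - \<i> / 2 \<in> ball (of_real x) 1" "of_real x \<in> ball (complex_of_real x) 1"
    by (simp_all add: dist_norm norm_divide)
  ultimately have "\<not> h constant_on ball (of_real x) 1"
    unfolding constant_on_def by metis
  then have "deriv h (of_real x) \<noteq> 0"
    using \<open>entire h\<close> a(5) \<open>h (of_real x) = 0\<close>
    by (intro deriv_nonzero_if_Re_nonneg_below[of _ _ 1])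
      (auto simp: entire_def h_def intro: holomorphic_on_subset)
  moreover have "(h has_field_derivative a * deriv f (of_real x) * exp (- \<i> * of_real \<sigma> * of_real x)) (at (of_real x))"
    unfolding h_def using assms(3)
    by (auto intro!: derivative_eq_intros entire_DERIV[OF a(1)])
  ultimately show ?thesis
    by (auto dest: DERIV_imp_deriv)
qed

section \<open>Differentiation\<close>

lemma DERIV_norm_squared_along_line:
  assumes "(f has_field_derivative D) (at z)"
  shows "((\<lambda>t::real. (norm (f (z + of_real t * v)))\<^sup>2) has_real_derivative 2 * Re (cnj (f z) * D * v)) (at 0)"
proof -
  have "((\<lambda>t::real. z + of_real t * v) has_vector_derivative v) (at 0)"
    by (auto intro!: derivative_eq_intros simp: has_vector_derivative_def scaleR_conv_of_real)
  then have "((f \<circ> (\<lambda>t::real. z + of_real t * v)) has_vector_derivative v * D) (at 0)"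
    by (rule field_vector_diff_chain_at) (use assms in simp)
  then have der: "((\<lambda>t. f (z + of_real t * v)) has_vector_derivative v * D) (at 0)"
    by (simp add: o_def)
  have re: "((\<lambda>t. Re (f (z + of_real t * v))) has_real_derivative Re (v * D)) (at 0)"
    and im: "((\<lambda>t. Im (f (z + of_real t * v))) has_real_derivative Im (v * D)) (at 0)"
    using bounded_linear.has_vector_derivative[OF bounded_linear_Re der]
      bounded_linear.has_vector_derivative[OF bounded_linear_Im der]
    by (simp_all add: has_real_derivative_iff_has_vector_derivative)
  show ?thesis
    unfolding cmod_power2
    by (rule DERIV_cong[OF DERIV_add[OF DERIV_power[OF re, of 2] DERIV_power[OF im, of 2]]])
      (simp add: algebra_simps)
qed

text \<open>
  For \<open>f z \<noteq> 0\<close> this is \<open>Im (f' / f) \<ge> 0\<close>: the modulus does not decrease in the direction \<open>-\<i>\<close>. The shift of \<open>f\<close> that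
  moves \<open>z\<close> to the real axis stays in the class, so its reflection inequality compares the points
  \<open>z - \<i>t\<close> and \<open>z + \<i>t\<close>; the claim is the derivative of that comparison at \<open>t = 0\<close>.
\<close>

lemma tilted_positive_Im_logarithmic_derivative:
  assumes f: "tilted_positive \<sigma> a f" and "\<sigma> > 0" and "Im z \<le> 0"
  shows "Im (deriv f z * cnj (f z)) \<ge> 0"
proof (rule ccontr)
  assume "\<not> ?thesis"
  then have neg: "4 * Im (deriv f z * cnj (f z)) < 0" by simp
  define \<psi> where "\<psi> = (\<lambda>t::real. (norm (f (z + of_real t * (- \<i>))))\<^sup>2 - (norm (f (z + of_real t * \<i>)))\<^sup>2)"
  have der: "(f has_field_derivative deriv f z) (at z)"
    using entire_DERIV[OF tilted_positiveD(1)[OF f]] .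
  have "(\<psi> has_real_derivative 4 * Im (deriv f z * cnj (f z))) (at 0)"
    unfolding \<psi>_def
    by (rule DERIV_cong[OF DERIV_diff[OF DERIV_norm_squared_along_line[OF der]
            DERIV_norm_squared_along_line[OF der]]]) (simp add: algebra_simps)
  then obtain d where "d > 0" and d: "\<And>t. 0 < t \<Longrightarrow> t < d \<Longrightarrow> \<psi> (0 + t) < \<psi> 0"
    using DERIV_neg_dec_right[OF _ neg] by blast
  have "\<psi> (d / 2) < 0"
    using d[of "d / 2"] \<open>d > 0\<close> by (simp add: \<psi>_def)
  moreover have "norm (f (z + of_real (d / 2) * \<i>)) \<le> norm (f (z + of_real (d / 2) * (- \<i>)))"
  proof -
    define w where "w = of_real (Re z) - \<i> * of_real (d / 2)"
    have "cnj w - \<i> * of_real (- Im z) = z + of_real (d / 2) * \<i>"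
      "w - \<i> * of_real (- Im z) = z + of_real (d / 2) * (- \<i>)"
      by (simp_all add: w_def complex_eq_iff)
    moreover have "tilted_positive \<sigma> a (\<lambda>z'. f (z' - \<i> * of_real (- Im z)))"
      using assms(3) by (intro tilted_positive_shift[OF f \<open>\<sigma> > 0\<close>]) simp
    moreover have "Im w \<le> 0"
      using \<open>d > 0\<close> by (simp add: w_def)
    ultimately show ?thesis
      using tilted_positive_reflection_le[OF _ \<open>\<sigma> > 0\<close>, of a _ w] by metis
  qed
  then have "\<psi> (d / 2) \<ge> 0"
    unfolding \<psi>_def by (simp add: power_mono)
  ultimately show False
    by simp
qed

text \<open>
  Let \<open>h\<close> and \<open>q\<close> be the tilted values of \<open>f\<close> and \<open>f'\<close> at \<open>z\<close>. For \<open>W = f + \<mu> * cnj a * exp (\<i>\<sigma>z)\<close> they become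
  \<open>h + \<mu>\<close> and \<open>q + \<sigma>\<mu>\<close>, and \<open>Im (W' / W) \<ge> 0\<close> says \<open>Re ((q + \<sigma>\<mu>) * cnj (h + \<mu>)) \<ge> 0\<close>. If
  \<open>Re q < 0\<close>, then \<open>q + \<sigma>\<mu>\<close> vanishes at some \<open>\<mu>\<close> with \<open>Re \<mu> > 0\<close>, and near this \<open>\<mu>\<close> it takes all
  directions while \<open>h + \<mu>\<close> hardly varies, a contradiction.
\<close>

lemma tilted_positive_deriv:
  assumes f: "tilted_positive \<sigma> a f" and "\<sigma> > 0"
  shows "tilted_positive \<sigma> (- \<i> * a) (deriv f)"
proof -
  note a = tilted_positiveD[OF f]
  have "Re (- \<i> * a * deriv f z * exp (- \<i> * of_real \<sigma> * z)) \<ge> 0" if z: "Im z \<le> 0" for z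
  proof (rule ccontr)
    assume neg: "\<not> ?thesis"
    define s where "s = exp (\<i> * of_real \<sigma> * z)"
    define h where "h = a * f z * exp (- \<i> * of_real \<sigma> * z)"
    define q where "q = - \<i> * a * deriv f z * exp (- \<i> * of_real \<sigma> * z)"
    have "Re h \<ge> 0" "Re q < 0"
      using a(5)[OF z] neg by (auto simp: h_def q_def)
    have ss: "exp (- \<i> * of_real \<sigma> * z) * s = 1"
      by (simp add: s_def flip: exp_add)
    have f_eq: "f z = cnj a * s * h"
    proof -
      have "cnj a * s * h = (a * cnj a) * (exp (- \<i> * of_real \<sigma> * z) * s) * f z"
        unfolding h_def by (simp only: mult_ac)
      then show ?thesis by (simp only: a(4) ss mult_1)
    qed
    have f'_eq: "deriv f z = \<i> * cnj a * s * q"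
    proof -
      have "\<i> * cnj a * s * q = (a * cnj a) * (exp (- \<i> * of_real \<sigma> * z) * s) * (\<i> * (- \<i>) * deriv f z)"
        unfolding q_def by (simp only: mult_ac)
      then show ?thesis by (simp only: a(4) ss mult_1) simp
    qed
    \<comment> \<open>At \<open>\<mu>\<^sub>0\<close> the derivative of the perturbed function vanishes. Moving from there against \<open>k\<close>, the
        value of \<open>h + \<mu>\<close> at \<open>\<mu>\<^sub>0\<close>, makes \<open>q + \<sigma>\<mu>\<close> a negative multiple of \<open>h + \<mu>\<close>; the step \<open>t\<close> is small
        enough to keep \<open>Re \<mu> \<ge> 0\<close>.\<close>
    define \<mu>\<^sub>0 where "\<mu>\<^sub>0 = - q / of_real \<sigma>"
    have "Re \<mu>\<^sub>0 > 0"
      using \<open>Re q < 0\<close> \<open>\<sigma> > 0\<close> by (simp add: \<mu>\<^sub>0_def divide_neg_pos)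
    define k where "k = h + \<mu>\<^sub>0"
    have "Re k > 0" "Re \<mu>\<^sub>0 \<le> Re k"
      using \<open>Re h \<ge> 0\<close> \<open>Re \<mu>\<^sub>0 > 0\<close> by (simp_all add: k_def)
    define t where "t = Re \<mu>\<^sub>0 / (2 * Re k)"
    have t: "0 < t" "t < 1"
      using \<open>Re k > 0\<close> \<open>Re \<mu>\<^sub>0 > 0\<close> \<open>Re \<mu>\<^sub>0 \<le> Re k\<close> by (auto simp: t_def)
    define \<mu> where "\<mu> = \<mu>\<^sub>0 - of_real t * k"
    have "Re \<mu> \<ge> 0"
      using \<open>Re k > 0\<close> \<open>Re \<mu>\<^sub>0 > 0\<close> by (simp add: \<mu>_def t_def)
    define W where "W = (\<lambda>z. f z + \<mu> * cnj a * exp (\<i> * of_real \<sigma> * z))"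
    have "tilted_positive \<sigma> a W"
      unfolding W_def by (intro tilted_positive_add_exp f \<open>\<sigma> > 0\<close> \<open>Re \<mu> \<ge> 0\<close>)
    then have "Im (deriv W z * cnj (W z)) \<ge> 0"
      by (rule tilted_positive_Im_logarithmic_derivative[OF _ \<open>\<sigma> > 0\<close> z])
    moreover have "W z = cnj a * s * of_real (1 - t) * k"
      unfolding W_def s_def[symmetric] f_eq \<mu>_def k_def by (simp add: algebra_simps)
    moreover have "deriv W z = - \<i> * cnj a * s * of_real (\<sigma> * t) * k"
    proof -
      have "deriv W z = deriv f z + \<mu> * cnj a * (\<i> * of_real \<sigma> * s)"
        unfolding W_def s_def
        by (rule DERIV_imp_deriv) (auto intro!: derivative_eq_intros entire_DERIV[OF a(1)])
      also have "\<dots> = \<i> * cnj a * s * (q + of_real \<sigma> * \<mu>)"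
        by (simp add: f'_eq algebra_simps)
      also have "q + of_real \<sigma> * \<mu> = - of_real (\<sigma> * t) * k"
        using \<open>\<sigma> > 0\<close> by (simp add: \<mu>_def \<mu>\<^sub>0_def field_simps)
      finally show ?thesis by simp
    qed
    moreover have "(- \<i> * cnj a * s * of_real (\<sigma> * t) * k) * cnj (cnj a * s * of_real (1 - t) * k)
        = - \<i> * of_real (\<sigma> * t * (1 - t) * (norm (s * k))\<^sup>2)"
    proof -
      have "(- \<i> * cnj a * s * of_real (\<sigma> * t) * k) * cnj (cnj a * s * of_real (1 - t) * k)
          = - \<i> * (a * cnj a) * of_real (\<sigma> * t) * of_real (1 - t) * ((s * k) * cnj (s * k))"
        by (simp only: complex_cnj_mult complex_cnj_cnj complex_cnj_complex_of_real mult_ac)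
      then show ?thesis
        by (simp only: a(4) of_real_mult mult.assoc mult_1 mult_1_right complex_norm_square[of "s * k"])
    qed
    ultimately have "Im (- \<i> * of_real (\<sigma> * t * (1 - t) * (norm (s * k))\<^sup>2)) \<ge> 0"
      by (simp only:)
    moreover have "k \<noteq> 0" "s \<noteq> 0"
      using \<open>Re k > 0\<close> by (auto simp: s_def)
    then have "\<sigma> * t * (1 - t) * (norm (s * k))\<^sup>2 > 0"
      using t \<open>\<sigma> > 0\<close> by simp
    ultimately show False
      by simp
  qed
  moreover have "norm (- \<i> * a) = 1"
    using a(3) by (simp add: norm_mult)
  ultimately show ?thesis
    using entire_deriv[OF a(1)] sublinear_type_deriv[OF a(1,2) \<open>\<sigma> > 0\<close>]
    unfolding tilted_positive_def by blast
qed

lemma deriv_nonzero_on_real_axis: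
  fixes x :: real
  assumes f: "tilted_positive \<sigma> a f" and "\<sigma> > 0" and "\<not> real_up_to_constant f"
  shows "deriv f (of_real x) \<noteq> 0"
proof (cases "f (of_real x) = 0")
  case True
  then show ?thesis
    using tilted_positive_simple_real_zero[OF f assms(3)] by blast
next
  case False
  note a = tilted_positiveD[OF f]
  have "bar f (of_real x) * deriv f (of_real x) - deriv (bar f) (of_real x) * f (of_real x) \<noteq> 0"
    by (rule wronskian_nonzero[OF a(1) tilted_positive_reflection_le[OF f \<open>\<sigma> > 0\<close>] False assms(3)])
  then show ?thesis
    by (auto simp: deriv_bar[OF a(1)])
qed

text \<open>
  If \<open>f' = c * g\<close> with \<open>g\<close> real, then positivity of \<open>f'\<close> on the real axis says that \<open>g x\<close> times
  \<open>cos (\<sigma>x - Arg p)\<close> is nonnegative, where \<open>p = -\<i> * a * c\<close>. The cosine takes both signs, so \<open>g\<close> has a real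
  zero. But \<open>f'\<close> has none.
\<close>

lemma deriv_not_real_up_to_constant:
  assumes f: "tilted_positive \<sigma> a f" and "\<sigma> > 0" and "\<not> real_up_to_constant f"
  shows "\<not> real_up_to_constant (deriv f)"
proof
  assume "real_up_to_constant (deriv f)"
  then obtain c g where "entire g" "real_function g" and f'_eq: "\<And>z. deriv f z = c * g z"
    by (auto simp: real_up_to_constant_def)
  have "c \<noteq> 0" and g_nz: "g (of_real x) \<noteq> 0" for x :: real
    using deriv_nonzero_on_real_axis[OF assms] f'_eq by force+
  define G where "G = (\<lambda>x::real. Re (g (of_real x)))"
  have g_eq: "g (of_real x) = of_real (G x)" for x
    using \<open>real_function g\<close> by (simp add: G_def real_function_def)
  define p where "p = - \<i> * a * c"
  have "norm a = 1"
    using tilted_positiveD(3)[OF f] .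
  then have "p \<noteq> 0"
    using \<open>c \<noteq> 0\<close> by (auto simp: p_def)
  have pos: "G x * Re (p * exp (- \<i> * of_real (\<sigma> * x))) \<ge> 0" for x
  proof -
    have "0 \<le> Re (- \<i> * a * deriv f (of_real x) * exp (- \<i> * of_real \<sigma> * of_real x))"
      by (rule tilted_positiveD(5)[OF tilted_positive_deriv[OF f \<open>\<sigma> > 0\<close>]]) simp
    also have "- \<i> * a * deriv f (of_real x) * exp (- \<i> * of_real \<sigma> * of_real x)
        = of_real (G x) * (p * exp (- \<i> * of_real (\<sigma> * x)))"
      by (simp add: f'_eq g_eq p_def mult_ac)
    finally show ?thesis
      by (simp only: times_complex.sel Re_complex_of_real Im_complex_of_real mult_zero_left diff_zero)
  qed
  define x\<^sub>0 where "x\<^sub>0 = Arg p / \<sigma>"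
  have p_eq: "p = of_real (norm p) * cis (Arg p)"
    using rcis_cmod_Arg[of p] by (simp add: rcis_def)
  have "p * exp (- \<i> * of_real (\<sigma> * x\<^sub>0)) = of_real (norm p)"
    using \<open>\<sigma> > 0\<close> by (subst p_eq) (simp add: x\<^sub>0_def cis_conv_exp mult.assoc flip: exp_add)
  moreover have "p * exp (- \<i> * of_real (\<sigma> * (x\<^sub>0 + pi / \<sigma>))) = - of_real (norm p)"
  proof -
    have "p * exp (- \<i> * of_real (\<sigma> * (x\<^sub>0 + pi / \<sigma>))) = of_real (norm p) * cis (- pi)"
      using \<open>\<sigma> > 0\<close> by (subst p_eq)
        (simp add: x\<^sub>0_def cis_conv_exp mult.assoc algebra_simps flip: exp_add)
    moreover have "cis (- pi) = - 1"
      by (simp add: complex_eq_iff)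
    ultimately show ?thesis
      by (simp only: mult_minus_right mult_1_right)
  qed
  ultimately have "G x\<^sub>0 \<ge> 0" "G (x\<^sub>0 + pi / \<sigma>) \<le> 0"
    using pos[of x\<^sub>0] pos[of "x\<^sub>0 + pi / \<sigma>"] \<open>p \<noteq> 0\<close>
    by (auto simp: zero_le_mult_iff mult_le_0_iff)
  moreover have "continuous_on UNIV g"
    using \<open>entire g\<close> by (auto simp: entire_def intro: holomorphic_on_imp_continuous_on)
  then have "continuous_on {x\<^sub>0..x\<^sub>0 + pi / \<sigma>} (\<lambda>x. g (of_real x))"
    by (rule continuous_on_compose2) (auto intro!: continuous_intros)
  then have "continuous_on {x\<^sub>0..x\<^sub>0 + pi / \<sigma>} G"
    unfolding G_def by (intro continuous_intros)
  moreover have "x\<^sub>0 \<le> x\<^sub>0 + pi / \<sigma>"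
    using \<open>\<sigma> > 0\<close> by simp
  ultimately obtain x where "G x = 0"
    using IVT2'[of G "x\<^sub>0 + pi / \<sigma>" 0 x\<^sub>0] by blast
  then show False
    using g_nz[of x] g_eq[of x] by simp
qed

section \<open>The Hermite-Biehler classes\<close>

text \<open>
  Equality at one point makes the quotient \<open>bar f / f\<close> constant, by the maximum principle.
\<close>

lemma reflection_less:
  assumes "entire f" and zero_free: "\<And>z. Im z < 0 \<Longrightarrow> f z \<noteq> 0"
    and dom: "\<And>z. Im z < 0 \<Longrightarrow> norm (f (cnj z)) \<le> norm (f z)"
    and "\<not> real_up_to_constant f" and "Im z < 0"
  shows "norm (f (cnj z)) < norm (f z)"
proof (rule ccontr)
  assume "\<not> ?thesis"
  then have eq: "norm (f (cnj z)) = norm (f z)"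
    using dom[OF \<open>Im z < 0\<close>] by simp
  define U where "U = {z. Im z < 0}"
  have U: "open U" "connected U" "z \<in> U"
    using \<open>Im z < 0\<close> by (auto simp: U_def open_halfspace_Im_lt)
  define \<theta> where "\<theta> = (\<lambda>z. bar f z / f z)"
  have "f holomorphic_on U" "bar f holomorphic_on U"
    using \<open>entire f\<close> entire_bar[OF \<open>entire f\<close>] by (auto simp: entire_def intro: holomorphic_on_subset)
  then have "\<theta> holomorphic_on U"
    unfolding \<theta>_def by (intro holomorphic_intros) (use zero_free in \<open>auto simp: U_def\<close>)
  moreover have "norm (\<theta> w) \<le> norm (\<theta> z)" if "w \<in> U" for w
    using that dom[of w] zero_free[of w] zero_free[of z] eq \<open>Im z < 0\<close>
    by (simp add: \<theta>_def U_def norm_divide norm_bar divide_le_eq)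
  ultimately have "\<theta> constant_on U"
    using U by (intro maximum_modulus_principle[of \<theta> U U z]) auto
  then obtain c where c: "\<And>w. w \<in> U \<Longrightarrow> \<theta> w = c"
    by (auto simp: constant_on_def)
  have "bar f w = c * f w" if "w \<in> U" for w
    using c[OF that] zero_free[of w] that by (auto simp: \<theta>_def U_def)
  moreover have "entire (\<lambda>w. c * f w)"
    using \<open>entire f\<close> unfolding entire_def by (intro holomorphic_intros)
  ultimately have "bar f w = c * f w" for w
    using U entire_eqI[OF entire_bar[OF \<open>entire f\<close>], of "\<lambda>w. c * f w" U] by blast
  then show False
    using real_up_to_constantI[OF \<open>entire f\<close>, of c] \<open>\<not> real_up_to_constant f\<close> by blast
qed

lemma tilted_positive_in_HB_closed:
  assumes f: "tilted_positive \<sigma> a f" and "\<sigma> > 0" and "\<not> real_up_to_constant f"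
  shows "f \<in> HB_closed"
proof -
  have zero_free: "f z \<noteq> 0" if "Im z < 0" for z
    using tilted_positive_zero_free[OF f assms(3) that] .
  moreover have "norm (f z / bar f z) \<le> 1" if "Im z > 0" for z
    using tilted_positive_reflection_le[OF f \<open>\<sigma> > 0\<close>, of "cnj z"] zero_free[of "cnj z"] that
    by (simp add: norm_divide norm_bar divide_le_eq)
  ultimately show ?thesis
    using tilted_positiveD(1)[OF f] by (simp add: HB_closed_def)
qed

lemma deriv_in_HB:
  assumes f: "tilted_positive \<sigma> a f" and "\<sigma> > 0" and "\<not> real_up_to_constant f"
  shows "deriv f \<in> HB"
proof -
  note f' = tilted_positive_deriv[OF f \<open>\<sigma> > 0\<close>] and not_real = deriv_not_real_up_to_constant[OF assms]
  have below: "deriv f z \<noteq> 0" if "Im z < 0" for z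
    using tilted_positive_zero_free[OF f' not_real that] .
  have zero_free: "deriv f z \<noteq> 0" if "Im z \<le> 0" for z
  proof (cases "Im z = 0")
    case True
    then have "z = of_real (Re z)"
      by (simp add: complex_eq_iff)
    then show ?thesis
      using deriv_nonzero_on_real_axis[OF assms, of "Re z"] by simp
  qed (use below that in simp)
  have "norm (deriv f z / bar (deriv f) z) < 1" if "Im z > 0" for z
  proof -
    have "norm (deriv f (cnj (cnj z))) < norm (deriv f (cnj z))"
      by (rule reflection_less[OF tilted_positiveD(1)[OF f'] below _ not_real])
        (use that tilted_positive_reflection_le[OF f' \<open>\<sigma> > 0\<close>] in auto)
    then show ?thesis
      using below[of "cnj z"] that by (simp add: norm_divide norm_bar divide_less_eq)
  qed
  then show ?thesis
    using tilted_positiveD(1)[OF f'] zero_free by (simp add: HB_def)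
qed

lemma tilted_positive_higher_deriv:
  assumes f: "tilted_positive \<sigma> a f" and "\<sigma> > 0" and "\<not> real_up_to_constant f"
  shows "\<exists>b. tilted_positive \<sigma> b ((deriv ^^ n) f) \<and> \<not> real_up_to_constant ((deriv ^^ n) f)"
proof (induction n)
  case 0
  show ?case
    using f assms(3) by (intro exI[of _ a]) simp
next
  case (Suc n)
  then obtain b where b: "tilted_positive \<sigma> b ((deriv ^^ n) f)" "\<not> real_up_to_constant ((deriv ^^ n) f)"
    by blast
  show ?case
    unfolding funpow.simps o_apply
    by (intro exI[of _ "- \<i> * b"] conjI tilted_positive_deriv[OF b(1)] deriv_not_real_up_to_constant[OF b(1) _ b(2)] \<open>\<sigma> > 0\<close>)
qed

lemma higher_deriv_in_HB:
  assumes f: "tilted_positive \<sigma> a f" and "\<sigma> > 0" and "\<not> real_up_to_constant f" and "n \<ge> 1"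
  shows "(deriv ^^ n) f \<in> HB"
proof (cases n)
  case (Suc m)
  show ?thesis
    using tilted_positive_higher_deriv[OF assms(1-3), of m] deriv_in_HB[OF _ \<open>\<sigma> > 0\<close>]
    unfolding Suc funpow.simps o_apply by blast
qed (use assms(4) in simp)

section \<open>Members of the class from the hypotheses of the theorem\<close>

lemma E_class_bound:
  assumes "f \<in> E_class \<sigma>" and "\<epsilon> > 0"
  shows "\<exists>A. \<forall>z. norm (f z) \<le> A * exp ((\<sigma> + \<epsilon>) * norm z)"
proof -
  have "exp_bounds f \<noteq> {}" "Inf (exp_bounds f) < \<sigma> + \<epsilon>"
    using assms by (auto simp: E_class_def exponential_type_def exp_type_def)
  then obtain B where "B \<in> exp_bounds f" "B < \<sigma> + \<epsilon>"
    by (meson cInf_lessD)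
  then obtain A where "A > 0" and A: "\<And>z. norm (f z) \<le> A * exp (B * norm z)"
    by (auto simp: exp_bounds_def)
  have "A * exp (B * norm z) \<le> A * exp ((\<sigma> + \<epsilon>) * norm z)" for z
    using \<open>A > 0\<close> \<open>B < \<sigma> + \<epsilon>\<close> by (auto intro!: mult_right_mono)
  then show ?thesis
    using A order_trans by blast
qed

lemma sublinear_on_real_axis:
  fixes f :: "complex \<Rightarrow> complex"
  assumes "entire f" and "\<epsilon> > 0"
    and top: "(\<lambda>x::real. f (of_real x)) \<in> o[at_top](\<lambda>x. of_real x)"
    and bot: "(\<lambda>x::real. f (of_real x)) \<in> o[at_bot](\<lambda>x. of_real x)"
  shows "\<exists>C. \<forall>x::real. norm (f (of_real x)) \<le> \<epsilon> * \<bar>x\<bar> + C"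
proof -
  obtain u where u: "\<And>x. x \<ge> u \<Longrightarrow> norm (f (of_real x)) \<le> \<epsilon> * \<bar>x\<bar>"
    using landau_o.smallD[OF top \<open>\<epsilon> > 0\<close>] by (auto simp: eventually_at_top_linorder)
  obtain l where l: "\<And>x. x \<le> l \<Longrightarrow> norm (f (of_real x)) \<le> \<epsilon> * \<bar>x\<bar>"
    using landau_o.smallD[OF bot \<open>\<epsilon> > 0\<close>] by (auto simp: eventually_at_bot_linorder)
  have "continuous_on UNIV f"
    using \<open>entire f\<close> by (auto simp: entire_def intro: holomorphic_on_imp_continuous_on)
  then have "continuous_on {l..u} (\<lambda>x. f (of_real x))"
    by (rule continuous_on_compose2) (auto intro!: continuous_intros)
  then have "bounded ((\<lambda>x. f (of_real x)) ` {l..u})"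
    by (intro compact_imp_bounded compact_continuous_image) auto
  then obtain C where "C > 0" and C: "\<And>x. x \<in> {l..u} \<Longrightarrow> norm (f (of_real x)) \<le> C"
    by (auto simp: bounded_pos)
  have "norm (f (of_real x)) \<le> \<epsilon> * \<bar>x\<bar> + C" for x
  proof (cases "x \<in> {l..u}")
    case True
    moreover have "0 \<le> \<epsilon> * \<bar>x\<bar>"
      using \<open>\<epsilon> > 0\<close> by simp
    ultimately show ?thesis
      using C[of x] by linarith
  next
    case False
    then have "norm (f (of_real x)) \<le> \<epsilon> * \<bar>x\<bar>"
      using u[of x] l[of x] by auto
    then show ?thesis
      using \<open>C > 0\<close> by linarith
  qed
  then show ?thesis by blast
qed

text \<open>
  By \<open>bar \<omega> = P - \<i>Q\<close>, the Wronskian of the preceding lemmas is \<open>2\<i> * d\<close>.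
\<close>

theorem theorem1p2:
  fixes \<sigma> \<tau> :: real and \<omega> P Q d :: "complex \<Rightarrow> complex"
  assumes "\<sigma> > 0"
    and "P \<in> E_class \<sigma>" and "real_function P"
    and "Q \<in> E_class \<sigma>" and "real_function Q"
    and "\<And>z. \<omega> z = P z + \<i> * Q z"
    and "(\<lambda>x::real. \<omega> (of_real x)) \<in> o[at_top](\<lambda>x. of_real x)"
    and "(\<lambda>x::real. \<omega> (of_real x)) \<in> o[at_bot](\<lambda>x. of_real x)"
    and "\<And>x::real. Re (P (of_real x)) * cos (\<sigma> * x + \<tau>) + Re (Q (of_real x)) * sin (\<sigma> * x + \<tau>) \<ge> 0"
    and "\<And>z. d z = P z * deriv Q z - deriv P z * Q z"
    and "\<not> real_up_to_constant \<omega>"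
  shows "(\<omega> \<in> HB_closed \<and>
          (\<forall>x::real. \<omega> (of_real x) = 0 \<longrightarrow> zorder \<omega> (of_real x) = 1)) \<and>
         ((\<forall>x::real. d (of_real x) = 0 \<longleftrightarrow> \<omega> (of_real x) = 0) \<and>
          (\<forall>x::real. \<omega> (of_real x) = 0 \<longrightarrow> zorder d (of_real x) = 2)) \<and>
         (\<forall>n\<ge>1. (deriv ^^ n) \<omega> \<in> HB)"
proof -
  have "entire P" "entire Q"
    using assms(2,4) by (auto simp: E_class_def)
  have \<omega>_eq: "\<omega> = (\<lambda>z. P z + \<i> * Q z)"
    using assms(6) by (simp add: fun_eq_iff)
  have "entire \<omega>"
    using \<open>entire P\<close> \<open>entire Q\<close> unfolding \<omega>_eq entire_def by (intro holomorphic_intros)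
  have "sublinear_type \<sigma> \<omega>"
  proof (rule sublinear_typeI[OF \<open>entire \<omega>\<close> \<open>\<sigma> > 0\<close>])
    fix \<epsilon> :: real assume "\<epsilon> > 0"
    obtain A where A: "\<And>z. norm (P z) \<le> A * exp ((\<sigma> + \<epsilon>) * norm z)"
      using E_class_bound[OF assms(2) \<open>\<epsilon> > 0\<close>] by blast
    obtain B where B: "\<And>z. norm (Q z) \<le> B * exp ((\<sigma> + \<epsilon>) * norm z)"
      using E_class_bound[OF assms(4) \<open>\<epsilon> > 0\<close>] by blast
    have "norm (\<omega> z) \<le> (A + B) * exp ((\<sigma> + \<epsilon>) * norm z)" for z
    proof -
      have "norm (P z + \<i> * Q z) \<le> A * exp ((\<sigma> + \<epsilon>) * norm z) + B * exp ((\<sigma> + \<epsilon>) * norm z)"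
        using A[of z] B[of z] by (intro norm_triangle_mono) (auto simp: norm_mult)
      then show ?thesis
        by (simp add: \<omega>_eq algebra_simps)
    qed
    then show "\<exists>A. \<forall>z. norm (\<omega> z) \<le> A * exp ((\<sigma> + \<epsilon>) * norm z)"
      by blast
    show "\<exists>C. \<forall>x::real. norm (\<omega> (of_real x)) \<le> \<epsilon> * \<bar>x\<bar> + C"
      by (rule sublinear_on_real_axis[OF \<open>entire \<omega>\<close> \<open>\<epsilon> > 0\<close> assms(7,8)])
  qed
  have \<omega>: "tilted_positive \<sigma> (cis (- \<tau>)) \<omega>"
  proof (rule tilted_positiveI[OF \<open>entire \<omega>\<close> \<open>sublinear_type \<sigma> \<omega>\<close>])
    fix x :: real
    have "Im (P (of_real x)) = 0" "Im (Q (of_real x)) = 0"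
      using assms(3,5) by (auto simp: real_function_def complex_is_Real_iff)
    then have "Re (\<omega> (of_real x) * cis (- (\<sigma> * x + \<tau>))) \<ge> 0"
      using assms(9)[of x] by (simp add: \<omega>_eq del: minus_add_distrib)
    moreover have "cis (- \<tau>) * \<omega> (of_real x) * exp (- \<i> * of_real \<sigma> * of_real x)
        = \<omega> (of_real x) * cis (- (\<sigma> * x + \<tau>))"
      by (simp add: cis_conv_exp mult_ac algebra_simps flip: exp_add)
    ultimately show "Re (cis (- \<tau>) * \<omega> (of_real x) * exp (- \<i> * of_real \<sigma> * of_real x)) \<ge> 0"
      by (simp only:)
  qed simp
  have simple: "deriv \<omega> (of_real x) \<noteq> 0" if "\<omega> (of_real x) = 0" for x :: real
    using tilted_positive_simple_real_zero[OF \<omega> assms(11) that] .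
  have order_\<omega>: "zorder \<omega> (of_real x) = 1" if "\<omega> (of_real x) = 0" for x :: real
    by (rule zorder_zero_eqI[of \<omega> UNIV])
      (use \<open>entire \<omega>\<close> that simple[OF that] in \<open>auto simp: entire_def\<close>)
  define W where "W = (\<lambda>z. bar \<omega> z * deriv \<omega> z - deriv (bar \<omega>) z * \<omega> z)"
  have bar_\<omega>: "bar \<omega> = (\<lambda>z. P z - \<i> * Q z)"
    using bar_real_parts[OF \<open>entire P\<close> \<open>entire Q\<close> assms(3,5,6)] by (simp add: fun_eq_iff)
  have deriv_\<omega>: "deriv \<omega> z = deriv P z + \<i> * deriv Q z" for z
    unfolding \<omega>_eq
    by (auto intro!: DERIV_imp_deriv derivative_eq_intros
        entire_DERIV[OF \<open>entire P\<close>] entire_DERIV[OF \<open>entire Q\<close>])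
  have deriv_bar_\<omega>: "deriv (bar \<omega>) z = deriv P z - \<i> * deriv Q z" for z
    unfolding bar_\<omega>
    by (auto intro!: DERIV_imp_deriv derivative_eq_intros
        entire_DERIV[OF \<open>entire P\<close>] entire_DERIV[OF \<open>entire Q\<close>])
  have W_eq: "W z = 2 * \<i> * d z" for z
    unfolding W_def deriv_bar_\<omega> deriv_\<omega> assms(10)
    unfolding bar_\<omega> assms(6) by (simp add: algebra_simps)
  note dom = tilted_positive_reflection_le[OF \<omega> \<open>\<sigma> > 0\<close>]
  have d_zero: "d (of_real x) = 0 \<longleftrightarrow> \<omega> (of_real x) = 0" for x :: real
  proof
    assume "d (of_real x) = 0"
    then have "W (of_real x) = 0"
      by (simp add: W_eq)
    then show "\<omega> (of_real x) = 0"
      using wronskian_nonzero[OF \<open>entire \<omega>\<close> dom _ assms(11), of x] by (auto simp: W_def)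
  next
    assume "\<omega> (of_real x) = 0"
    then have "W (of_real x) = 0"
      by (simp add: W_def)
    then show "d (of_real x) = 0"
      by (simp add: W_eq)
  qed
  have order_d: "zorder d (of_real x) = 2" if "\<omega> (of_real x) = 0" for x :: real
  proof -
    have "zorder W (of_real x) = 2"
      unfolding W_def
      by (rule zorder_wronskian_at_simple_zero[OF \<open>entire \<omega>\<close> dom that simple[OF that] assms(11)])
    moreover have "W = (\<lambda>z. 2 * \<i> * d z)"
      by (simp add: W_eq fun_eq_iff)
    ultimately show ?thesis
      by (simp add: zorder_cmult)
  qed
  show ?thesis
    using tilted_positive_in_HB_closed[OF \<omega> \<open>\<sigma> > 0\<close> assms(11)] order_\<omega> d_zero order_d
      higher_deriv_in_HB[OF \<omega> \<open>\<sigma> > 0\<close> assms(11)] by blast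
qed

end
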